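(* Let $n\ge 2$ and let $(L,\mu,\Delta)$ be an $m$-dimensional $n$-Lie bialgebra over a field $\mathbb F$ of characteristic zero, with basis $x_1,\dots,x_m$. Let $x_0,x_{-1}$ be elements not contained in $L$, and let $B:L\otimes L\to\mathbb F$ be a symmetric bilinear form that is $\mathrm{ad}_\mu$-invariant, i.e. $B(\mu(y_1,\dots,y_{n-1},x),z)+B(x,\mu(y_1,\dots,y_{n-1},z))=0$ for all $y_1,\dots,y_{n-1},x,z\in L$. Put $\bar L=L\oplus\mathbb F x_0\oplus\mathbb F x_{-1}$ (so $\{x_{-1},x_0,x_1,\dots,x_m\}$ is a basis of $\bar L$, with dual basis $\{x^{-1},x^0,x^1,\dots,x^m\}$ of $\bar L^*$). Let $\bar\mu:\bar L^{\wedge(n+1)}\to\bar L$ be the alternating $(n+1)$-linear map determined by: - $\bar\mu(x_{i_1},\dots,x_0,\dots,x_{i_n})=(-1)^{k-1}\mu(x_{i_1},\dots,x_{i_n})$ when $x_0$ is in the $k$-th position ($1\le k\le n+1$) and $1\le i_1,\dots,i_n\le m$; - $\bar\mu(x_{i_1},\dots,x_{-1},\dots,x_{i_n})=0$ whenever $x_{-1}$ occurs in any position, for $0\le i_1,\dots,i_n\le m$; - $\bar\mu(x_{i_1},\dots,x_{i_{n+1}})=B(\mu(x_{i_1},\dots,x_{i_n}),x_{i_{n+1}})\,x_{-1}$ for $1\le i_1,\dots,i_{n+1}\le m$. Let $\bar\Delta:\bar L\to\bar L^{\wedge(n+1)}$ be the linear map whose dual $\bar\Delta^*:(\bar L^*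 )^{\otimes(n+1)}\to\bar L^*$ is the alternating $(n+1)$-linear map determined by: - $\bar\Delta^*(x^{i_1},\dots,x^{-1},\dots,x^{i_n})=(-1)^{k-1}\Delta^*(x^{i_1},\dots,x^{i_n})$ when $x^{-1}$ is in the $k$-th position ($1\le k\le n+1$) and $1\le i_1,\dots,i_n\le m$; - $\bar\Delta^*$ vanishes on tuples of dual basis vectors in which $x^0$ occurs; - $\bar\Delta^*(x^{i_1},\dots,x^{i_{n+1}})=0$ for $1\le i_1,\dots,i_{n+1}\le m$. (Equivalently, $\bar\Delta(x_0)=\bar\Delta(x_{-1})=0$, and if $\Delta(x_k)=\sum_{1\le j_1<\cdots<j_n\le m}a_k^{j_1\cdots j_n}x_{j_1}\wedge\cdots\wedge x_{j_n}$ then $\bar\Delta(x_k)=\sum_{1\le j_1<\cdots<j_n\le m}a_k^{j_1\cdots j_n}x_{-1}\wedge x_{j_1}\wedge\cdots\wedge x_{j_n}$ for $1\le k\le m$.) Then $(\bar L,\bar\mu,\bar\Delta)$ is an $(m+2)$-dimensional $(n+1)$-Lie bialgebra.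
   Context: A hat means omission. An $n$-Lie algebra $(L,\mu)$ is a vector space $L$ over $\mathbb F$ with an alternating $n$-linear map $\mu:L^{\otimes n}\to L$ (so $\mu(x_1,\dots,x_n)=\mathrm{sign}(\sigma)\mu(x_{\sigma(1)},\dots,x_{\sigma(n)})$ for $\sigma\in S_n$) satisfying $$\mu(x_1,\dots,x_{n-1},\mu(y_1,\dots,y_n))=\sum_{s=1}^n(-1)^{n-s}\mu(y_1,\dots,\widehat{y_s},\dots,y_n,\mu(x_1,\dots,x_{n-1},y_s)).$$ $L^{\wedge n}$ is regarded as the space of skew-symmetric tensors in $L^{\otimes n}$, with $v_1\wedge\cdots\wedge v_n=\sum_{\sigma\in S_n}\mathrm{sign}(\sigma)v_{\sigma(1)}\otimes\cdots\otimes v_{\sigma(n)}$. For finite-dimensional $L$ and linear $\Delta:L\to L^{\otimes n}$, the dual map $\Delta^*:(L^* )^{\otimes n}\to L^*$ is given by $\langle\Delta^*(y^1,\dots,y^n),x\rangle=\langle y^1\otimes\cdots\otimes y^n,\Delta(x)\rangle$, where tensors are paired factorwise. An $n$-Lie coalgebra $(L,\Delta)$ is a vector space $L$ with a linear map $\Delta:L\to L^{\wedge n}$ such that $\big(1-\sum_{s=1}^n(-1)^{n-s}\omega_s\big)(1^{\otimes(n-1)}\otimes\Delta)\Delta=0$, where $\omega_s:L^{\otimes(n-1)}\otimes L^{\otimes n}\to L^{\otimes(n-1)}\otimes L^{\otimes n}$ is the linear map determined by $$\langle x_1\otimes\cdots\otimes x_{n-1}\otimes y_1\otimes\cdots\otimes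 y_n,\ \omega_s(w)\rangle=\langle y_1\otimes\cdots\otimes\widehat{y_s}\otimes\cdots\otimes y_n\otimes x_1\otimes\cdots\otimes x_{n-1}\otimes y_s,\ w\rangle$$ for all $x_i,y_j\in L^*$ and $w\in L^{\otimes(2n-1)}$. An $n$-Lie bialgebra is a triple $(L,\mu,\Delta)$ such that $(L,\mu)$ is an $n$-Lie algebra, $(L,\Delta)$ is an $n$-Lie coalgebra, and for all $x_1,\dots,x_n\in L$ $$\Delta\mu(x_1,\dots,x_n)=\sum_{s=1}^n\sum_{k=1}^n(-1)^{n-k}\rho^\mu_s(x_1,\dots,\widehat{x_k},\dots,x_n)\Delta(x_k),$$ where $\rho^\mu_s(z_1,\dots,z_{n-1})(y_1\otimes\cdots\otimes y_n)=y_1\otimes\cdots\otimes y_{s-1}\otimes\mu(z_1,\dots,z_{n-1},y_s)\otimes y_{s+1}\otimes\cdots\otimes y_n$. All these definitions apply with $n+1$ in place of $n$. In the definition of $\bar\Delta^*$, $L^*$ is identified with the span of $x^1,\dots,x^m$ in $\bar L^*$. *)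

theory Defs
  imports
    Complex_Main
    "HOL-Combinatorics.Combinatorics"
    "HOL-Library.Function_Algebras"
    "HOL-Library.Product_Plus"
begin

text \<open>
  An \<open>n\<close>-tuple is a list of length \<open>n\<close>; only the values of an \<open>n\<close>-ary map at lists of length \<open>n\<close>
  are meaningful. Positions \<open>s\<close>, \<open>k\<close> in a tuple are counted from 1, as in the usual formulas, so
  the \<open>s\<close>-th entry of \<open>ys\<close> is \<open>ys ! (s - 1)\<close>.
\<close>

definition omit :: "nat \<Rightarrow> 'b list \<Rightarrow> 'b list" where
  "omit s ys = take (s - 1) ys @ drop s ys"

definition put_at :: "nat \<Rightarrow> 'b \<Rightarrow> 'b list \<Rightarrow> 'b list" where
  "put_at k y ys = take (k - 1) ys @ y # drop (k - 1) ys"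


section \<open>\<open>n\<close>-Lie algebras\<close>

definition multilinear_map ::
  "('a::field \<Rightarrow> 'v::ab_group_add \<Rightarrow> 'v) \<Rightarrow> ('a \<Rightarrow> 'w::ab_group_add \<Rightarrow> 'w) \<Rightarrow> nat \<Rightarrow> ('v list \<Rightarrow> 'w) \<Rightarrow> bool"
where
  "multilinear_map scaleV scaleW n f \<longleftrightarrow>
     (\<forall>vs i. length vs = n \<longrightarrow> i < n \<longrightarrow> Vector_Spaces.linear scaleV scaleW (\<lambda>v. f (vs[i := v])))"

definition alternating_multilinear ::
  "('a::field \<Rightarrow> 'v::ab_group_add \<Rightarrow> 'v) \<Rightarrow> ('a \<Rightarrow> 'w::ab_group_add \<Rightarrow> 'w) \<Rightarrow> nat \<Rightarrow> ('v list \<Rightarrow> 'w) \<Rightarrow> bool"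
where
  "alternating_multilinear scaleV scaleW n f \<longleftrightarrow>
     multilinear_map scaleV scaleW n f \<and>
     (\<forall>\<sigma> vs. \<sigma> permutes {..<n} \<longrightarrow> length vs = n \<longrightarrow>
        f vs = scaleW (of_int (sign \<sigma>)) (f (permute_list \<sigma> vs)))"

locale n_lie_algebra = vector_space scale
  for scale :: "'a::field \<Rightarrow> 'v::ab_group_add \<Rightarrow> 'v" +
  fixes n :: nat and \<mu> :: "'v list \<Rightarrow> 'v"
  assumes alternating: "alternating_multilinear scale scale n \<mu>"
    and fundamental_identity:
      "\<lbrakk>length xs = n - 1; length ys = n\<rbrakk> \<Longrightarrow>
         \<mu> (xs @ [\<mu> ys]) =
         (\<Sum>s = 1..n. scale ((- 1) ^ (n - s)) (\<mu> (omit s ys @ [\<mu> (xs @ [ys ! (s - 1)])])))"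


section \<open>Tensor powers\<close>

definition dual_space :: "('a::field \<Rightarrow> 'v::ab_group_add \<Rightarrow> 'v) \<Rightarrow> ('v \<Rightarrow> 'a) set" where
  "dual_space scale = {f. Vector_Spaces.linear scale (*) f}"

text \<open>
  A tensor \<open>t \<in> L\<^sup>\<otimes>\<^sup>n\<close> is represented by the function \<open>(f\<^sub>1,\<dots>,f\<^sub>n) \<mapsto> \<langle>f\<^sub>1 \<otimes> \<dots> \<otimes> f\<^sub>n, t\<rangle>\<close> on
  \<open>n\<close>-tuples of elements of \<open>L\<^sup>*\<close>. Since \<open>L\<^sup>*\<close> separates points of \<open>L\<close>, the factorwise pairing embeds
  \<open>L\<^sup>\<otimes>\<^sup>n\<close> into the space of such functions, and the image is the span of the pure tensors.
  Outside the \<open>n\<close>-tuples from \<open>L\<^sup>*\<close> the representing function is set to 0, so that equality of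
  tensors is equality of functions.
\<close>

type_synonym ('a, 'v) tensor = "('v \<Rightarrow> 'a) list \<Rightarrow> 'a"

definition on_dual ::
  "('a::field \<Rightarrow> 'v::ab_group_add \<Rightarrow> 'v) \<Rightarrow> nat \<Rightarrow> ('a, 'v) tensor \<Rightarrow> ('a, 'v) tensor" where
  "on_dual scale n t = (\<lambda>fs. if length fs = n \<and> set fs \<subseteq> dual_space scale then t fs else 0)"

definition tensor_scale :: "'a::field \<Rightarrow> ('a, 'v) tensor \<Rightarrow> ('a, 'v) tensor" where
  "tensor_scale c t = (\<lambda>fs. c * t fs)"

definition pure_tensor ::
  "('a::field \<Rightarrow> 'v::ab_group_add \<Rightarrow> 'v) \<Rightarrow> 'v list \<Rightarrow> ('a, 'v) tensor" where
  "pure_tensor scale vs =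
     on_dual scale (length vs) (\<lambda>fs. \<Prod>i<length vs. (fs ! i) (vs ! i))"

definition tensor_power ::
  "('a::field \<Rightarrow> 'v::ab_group_add \<Rightarrow> 'v) \<Rightarrow> nat \<Rightarrow> ('a, 'v) tensor set" where
  "tensor_power scale n = module.span tensor_scale {pure_tensor scale vs |vs. length vs = n}"

text \<open>Skew-symmetric tensors; permuting tensor factors amounts to permuting the functionals.\<close>

definition wedge_power ::
  "('a::field \<Rightarrow> 'v::ab_group_add \<Rightarrow> 'v) \<Rightarrow> nat \<Rightarrow> ('a, 'v) tensor set" where
  "wedge_power scale n =
     {t \<in> tensor_power scale n.
        \<forall>\<sigma> fs. \<sigma> permutes {..<n} \<longrightarrow> length fs = n \<longrightarrow>
          t (permute_list \<sigma> fs) = of_int (sign \<sigma>) * t fs}"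

text \<open>
  The map \<open>1\<^sup>\<otimes>\<^sup>(\<^sup>n\<^sup>-\<^sup>1\<^sup>) \<otimes> \<Delta> : L\<^sup>\<otimes>\<^sup>n \<rightarrow> L\<^sup>\<otimes>\<^sup>(\<^sup>2\<^sup>n\<^sup>-\<^sup>1\<^sup>)\<close>, for linear \<open>\<Delta> : L \<rightarrow> L\<^sup>\<otimes>\<^sup>n\<close>. On functionals it
  pairs the last factor with \<open>v \<mapsto> \<langle>g\<^sub>1 \<otimes> \<dots> \<otimes> g\<^sub>n, \<Delta> v\<rangle>\<close>; see \<open>id_tensor_pure\<close> below.
\<close>

definition id_tensor ::
  "('a::field \<Rightarrow> 'v::ab_group_add \<Rightarrow> 'v) \<Rightarrow> nat \<Rightarrow> ('v \<Rightarrow> ('a, 'v) tensor)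
     \<Rightarrow> ('a, 'v) tensor \<Rightarrow> ('a, 'v) tensor" where
  "id_tensor scale n \<Delta> t =
     on_dual scale (2 * n - 1) (\<lambda>fs. t (take (n - 1) fs @ [\<lambda>v. \<Delta> v (drop (n - 1) fs)]))"

definition omega ::
  "('a::field \<Rightarrow> 'v::ab_group_add \<Rightarrow> 'v) \<Rightarrow> nat \<Rightarrow> nat \<Rightarrow> ('a, 'v) tensor \<Rightarrow> ('a, 'v) tensor" where
  "omega scale n s w =
     on_dual scale (2 * n - 1)
       (\<lambda>fs. let xs = take (n - 1) fs; ys = drop (n - 1) fs
             in w (omit s ys @ xs @ [ys ! (s - 1)]))"

text \<open>
  \<open>\<rho>\<^sub>s(z\<^sub>1,\<dots>,z\<^sub>n\<^sub>-\<^sub>1)\<close> applies \<open>\<mu>(z\<^sub>1,\<dots>,z\<^sub>n\<^sub>-\<^sub>1,_)\<close> to the \<open>s\<close>-th factor, i.e. composes the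
  \<open>s\<close>-th functional with it; see \<open>rho_pure\<close> below.
\<close>

definition rho ::
  "('a::field \<Rightarrow> 'v::ab_group_add \<Rightarrow> 'v) \<Rightarrow> nat \<Rightarrow> ('v list \<Rightarrow> 'v) \<Rightarrow> nat \<Rightarrow> 'v list
     \<Rightarrow> ('a, 'v) tensor \<Rightarrow> ('a, 'v) tensor" where
  "rho scale n \<mu> s zs t =
     on_dual scale n (\<lambda>fs. t (fs[s - 1 := (\<lambda>y. (fs ! (s - 1)) (\<mu> (zs @ [y])))]))"

definition dual_map :: "('v \<Rightarrow> ('a, 'v) tensor) \<Rightarrow> ('v \<Rightarrow> 'a) list \<Rightarrow> 'v \<Rightarrow> 'a" where
  "dual_map \<Delta> fs = (\<lambda>v. \<Delta> v fs)"


section \<open>\<open>n\<close>-Lie coalgebras and bialgebras\<close>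

locale n_lie_coalgebra = vector_space scale
  for scale :: "'a::field \<Rightarrow> 'v::ab_group_add \<Rightarrow> 'v" +
  fixes n :: nat and \<Delta> :: "'v \<Rightarrow> ('a, 'v) tensor"
  assumes linear_Delta: "Vector_Spaces.linear scale tensor_scale \<Delta>"
    and range_Delta: "\<Delta> v \<in> wedge_power scale n"
    and co_identity:
      "id_tensor scale n \<Delta> (\<Delta> v)
         - (\<Sum>s = 1..n. tensor_scale ((- 1) ^ (n - s)) (omega scale n s (id_tensor scale n \<Delta> (\<Delta> v)))) = 0"

locale n_lie_bialgebra =
  n_lie_algebra scale n \<mu> + n_lie_coalgebra scale n \<Delta>
  for scale :: "'a::field \<Rightarrow> 'v::ab_group_add \<Rightarrow> 'v"
    and n :: nat and \<mu> :: "'v list \<Rightarrow> 'v" and \<Delta> :: "'v \<Rightarrow> ('a, 'v) tensor" +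
  assumes compatibility:
    "length xs = n \<Longrightarrow>
       \<Delta> (\<mu> xs) =
       (\<Sum>s = 1..n. \<Sum>k = 1..n.
          tensor_scale ((- 1) ^ (n - k)) (rho scale n \<mu> s (omit k xs) (\<Delta> (xs ! (k - 1)))))"


section \<open>Indexed bases and dual bases\<close>

definition basis_family ::
  "('a::field \<Rightarrow> 'v::ab_group_add \<Rightarrow> 'v) \<Rightarrow> 'i set \<Rightarrow> ('i \<Rightarrow> 'v) \<Rightarrow> bool" where
  "basis_family scale I e \<longleftrightarrow>
     inj_on e I \<and> \<not> module.dependent scale (e ` I) \<and> module.span scale (e ` I) = UNIV"

definition dual_basis ::
  "('a::field \<Rightarrow> 'v::ab_group_add \<Rightarrow> 'v) \<Rightarrow> 'i set \<Rightarrow> ('i \<Rightarrow> 'v) \<Rightarrow> 'i \<Rightarrow> 'v \<Rightarrow> 'a" where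
  "dual_basis scale I e i = (\<lambda>v. module.representation scale (e ` I) v (e i))"


section \<open>The extension \<open>L \<oplus> \<F> x\<^sub>0 \<oplus> \<F> x\<^sub>-\<^sub>1\<close>\<close>

text \<open>
  The direct sum is the type \<open>'v \<times> 'a \<times> 'a\<close>, with \<open>L\<close> embedded as \<open>v \<mapsto> (v, 0, 0)\<close>,
  \<open>x\<^sub>0 = (0, 1, 0)\<close> and \<open>x\<^sub>-\<^sub>1 = (0, 0, 1)\<close>.
\<close>

definition ext_scale ::
  "('a::field \<Rightarrow> 'v::ab_group_add \<Rightarrow> 'v) \<Rightarrow> 'a \<Rightarrow> 'v \<times> 'a \<times> 'a \<Rightarrow> 'v \<times> 'a \<times> 'a" where
  "ext_scale scale c w = (scale c (fst w), c * fst (snd w), c * snd (snd w))"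

definition embed :: "'v \<Rightarrow> 'v \<times> 'a::field \<times> 'a" where
  "embed v = (v, 0, 0)"

definition ext_basis :: "(int \<Rightarrow> 'v::ab_group_add) \<Rightarrow> int \<Rightarrow> 'v \<times> 'a::field \<times> 'a" where
  "ext_basis x i = (if i = - 1 then (0, 0, 1) else if i = 0 then (0, 1, 0) else embed (x i))"

text \<open>
  \<open>L\<^sup>*\<close> as the span of \<open>x\<^sup>1,\<dots>,x\<^sup>m\<close> inside the dual of the extension, i.e. the functionals
  vanishing on \<open>x\<^sub>0\<close> and \<open>x\<^sub>-\<^sub>1\<close>.
\<close>

definition embed_dual :: "('v \<Rightarrow> 'a) \<Rightarrow> 'v \<times> 'a \<times> 'a \<Rightarrow> 'a" where
  "embed_dual f = f \<circ> fst"

definition is_ext_bracket ::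
  "('a::field \<Rightarrow> 'v::ab_group_add \<Rightarrow> 'v) \<Rightarrow> nat \<Rightarrow> nat \<Rightarrow> (int \<Rightarrow> 'v) \<Rightarrow> ('v list \<Rightarrow> 'v)
     \<Rightarrow> ('v \<Rightarrow> 'v \<Rightarrow> 'a) \<Rightarrow> (('v \<times> 'a \<times> 'a) list \<Rightarrow> 'v \<times> 'a \<times> 'a) \<Rightarrow> bool" where
  "is_ext_bracket scale n m x \<mu> B \<mu>' \<longleftrightarrow>
     alternating_multilinear (ext_scale scale) (ext_scale scale) (n + 1) \<mu>' \<and>
     (\<forall>is k. length is = n \<longrightarrow> set is \<subseteq> {1..int m} \<longrightarrow> k \<in> {1..n + 1} \<longrightarrow>
        \<mu>' (put_at k (ext_basis x 0) (map (ext_basis x) is)) =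
        ext_scale scale ((- 1) ^ (k - 1)) (embed (\<mu> (map x is)))) \<and>
     (\<forall>is k. length is = n \<longrightarrow> set is \<subseteq> {0..int m} \<longrightarrow> k \<in> {1..n + 1} \<longrightarrow>
        \<mu>' (put_at k (ext_basis x (- 1)) (map (ext_basis x) is)) = 0) \<and>
     (\<forall>is. length is = n + 1 \<longrightarrow> set is \<subseteq> {1..int m} \<longrightarrow>
        \<mu>' (map (ext_basis x) is) =
        ext_scale scale (B (\<mu> (map x (take n is))) (x (is ! n))) (ext_basis x (- 1)))"

text \<open>
  That the dual map is multilinear and alternating is contained in \<open>\<Delta>'\<close> being linear with values in
  the skew-symmetric tensors.
\<close>

definition is_ext_cobracket ::
  "('a::field \<Rightarrow> 'v::ab_group_add \<Rightarrow> 'v) \<Rightarrow> nat \<Rightarrow> nat \<Rightarrow> (int \<Rightarrow> 'v) \<Rightarrow> ('v \<Rightarrow> ('a, 'v) tensor)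
     \<Rightarrow> ('v \<times> 'a \<times> 'a \<Rightarrow> ('a, 'v \<times> 'a \<times> 'a) tensor) \<Rightarrow> bool" where
  "is_ext_cobracket scale n m x \<Delta> \<Delta>' \<longleftrightarrow>
     (let d = dual_basis scale {1..int m} x;
          d' = dual_basis (ext_scale scale) {- 1..int m} (ext_basis x)
      in
        Vector_Spaces.linear (ext_scale scale) tensor_scale \<Delta>' \<and>
        range \<Delta>' \<subseteq> wedge_power (ext_scale scale) (n + 1) \<and>
        (\<forall>is k. length is = n \<longrightarrow> set is \<subseteq> {1..int m} \<longrightarrow> k \<in> {1..n + 1} \<longrightarrow>
           dual_map \<Delta>' (put_at k (d' (- 1)) (map d' is)) =
           (\<lambda>w. (- 1) ^ (k - 1) * embed_dual (dual_map \<Delta> (map d is)) w)) \<and>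
        (\<forall>is. length is = n + 1 \<longrightarrow> set is \<subseteq> {- 1..int m} \<longrightarrow> 0 \<in> set is \<longrightarrow>
           dual_map \<Delta>' (map d' is) = 0) \<and>
        (\<forall>is. length is = n + 1 \<longrightarrow> set is \<subseteq> {1..int m} \<longrightarrow>
           dual_map \<Delta>' (map d' is) = 0))"


section \<open>Consistency of the encodings\<close>

lemma vector_space_tensor_scale: "vector_space (tensor_scale :: 'a::field \<Rightarrow> ('a, 'v) tensor \<Rightarrow> _)"
  by unfold_locales (auto simp: tensor_scale_def algebra_simps fun_eq_iff)

lemma (in vector_space) vector_space_ext_scale: "vector_space (ext_scale scale)"
  by unfold_locales (auto simp: ext_scale_def algebra_simps scale_right_distrib scale_left_distrib)

lemma tensor_power_zero_outside:
  assumes "t \<in> tensor_power scale n" "\<not> (length fs = n \<and> set fs \<subseteq> dual_space scale)"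
  shows "t fs = 0"
proof -
  interpret T: vector_space tensor_scale by (rule vector_space_tensor_scale)
  show ?thesis
    using assms(1) unfolding tensor_power_def
  proof (induction rule: T.span_induct_alt)
    case base then show ?case by simp
  next
    case (step c u t)
    then obtain vs where vs: "length vs = n" "u = pure_tensor scale vs" by auto
    then have "u fs = 0" using assms(2) unfolding pure_tensor_def on_dual_def by presburger
    with step show ?case by (simp add: tensor_scale_def)
  qed
qed

lemma rho_pure:
  assumes "vector_space scale" "multilinear_map scale scale n \<mu>"
    and "length zs = n - 1" "length ys = n" "1 \<le> s" "s \<le> n"
  shows "rho scale n \<mu> s zs (pure_tensor scale ys) =
         pure_tensor scale (ys[s - 1 := \<mu> (zs @ [ys ! (s - 1)])])"
proof
  fix fs
  have lin: "Vector_Spaces.linear scale scale (\<lambda>y. \<mu> (zs @ [y]))"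
  proof -
    have "Vector_Spaces.linear scale scale (\<lambda>v. \<mu> ((zs @ [0])[n - 1 := v]))"
      using assms by (auto simp: multilinear_map_def)
    moreover have "(zs @ [0])[n - 1 := v] = zs @ [v]" for v
      using assms(3) by (metis list_update_length)
    ultimately show ?thesis by simp
  qed
  show "rho scale n \<mu> s zs (pure_tensor scale ys) fs =
        pure_tensor scale (ys[s - 1 := \<mu> (zs @ [ys ! (s - 1)])]) fs"
  proof (cases "length fs = n \<and> set fs \<subseteq> dual_space scale")
    case True
    let ?g = "\<lambda>y. (fs ! (s - 1)) (\<mu> (zs @ [y]))"
    have "fs ! (s - 1) \<in> dual_space scale" using True assms by auto
    then have "?g \<in> dual_space scale"
      using Vector_Spaces.linear_compose[OF lin, of "(*)" "fs ! (s - 1)"]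
      by (simp add: dual_space_def o_def)
    then have "set (fs[s - 1 := ?g]) \<subseteq> dual_space scale"
      using True set_update_subset_insert[of fs "s - 1" ?g] by blast
    moreover have "(fs[s - 1 := ?g] ! i) (ys ! i) = (fs ! i) (ys[s - 1 := \<mu> (zs @ [ys ! (s - 1)])] ! i)"
      if "i < n" for i
      using that True assms by (auto simp: nth_list_update)
    ultimately show ?thesis
      using True assms by (simp add: rho_def on_dual_def pure_tensor_def)
  qed (use assms in \<open>auto simp: rho_def on_dual_def pure_tensor_def\<close>)
qed

lemma id_tensor_pure:
  assumes "Vector_Spaces.linear scale tensor_scale \<Delta>" "n \<ge> 1"
    and "length us = n - 1" "length fs = n - 1" "length gs = n"
    and "set fs \<subseteq> dual_space scale" "set gs \<subseteq> dual_space scale"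
  shows "id_tensor scale n \<Delta> (pure_tensor scale (us @ [v])) (fs @ gs) =
         pure_tensor scale us fs * \<Delta> v gs"
proof -
  interpret D: Vector_Spaces.linear scale tensor_scale \<Delta> by (fact assms(1))
  have "(\<lambda>v. \<Delta> v gs) \<in> dual_space scale"
    unfolding dual_space_def mem_Collect_eq
    by unfold_locales (auto simp: D.add D.scale tensor_scale_def algebra_simps)
  moreover obtain k where "n = Suc k" using assms(2) by (cases n) auto
  ultimately show ?thesis
    using assms(3-) by (auto simp: id_tensor_def on_dual_def pure_tensor_def nth_append)
qed

lemma omega_pure:
  assumes "length fs = n - 1" "length gs = n" "1 \<le> s" "s \<le> n"
    and "set fs \<subseteq> dual_space scale" "set gs \<subseteq> dual_space scale"
  shows "omega scale n s w (fs @ gs) = w (omit s gs @ fs @ [gs ! (s - 1)])"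
  using assms by (simp add: omega_def on_dual_def mult_2)

lemma dual_basis_apply:
  assumes "vector_space scale" "basis_family scale I e" "i \<in> I" "j \<in> I"
  shows "dual_basis scale I e i (e j) = (if i = j then 1 else 0)"
proof -
  interpret vector_space scale by fact
  show ?thesis
    using assms(2-) representation_basis[of "e ` I" "e j"]
    by (auto simp: dual_basis_def basis_family_def inj_on_eq_iff)
qed

lemma basis_family_ext_basis:
  fixes scale :: "'a::field \<Rightarrow> 'v::ab_group_add \<Rightarrow> 'v"
  assumes "vector_space scale" "basis_family scale {1..int m} x"
  shows "basis_family (ext_scale scale) {- 1..int m} (ext_basis x)"
proof -
  interpret V: vector_space scale by fact
  interpret E: vector_space "ext_scale scale" by (rule V.vector_space_ext_scale)
  have inj: "inj_on x {1..int m}" and ind: "V.independent (x ` {1..int m})"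
    and sp: "V.span (x ` {1..int m}) = UNIV"
    using assms(2) by (auto simp: basis_family_def)
  let ?e = "ext_basis x :: int \<Rightarrow> 'v \<times> 'a \<times> 'a"
  have I: "{- 1..int m} = {- 1, 0} \<union> {1..int m}" by auto
  have nz: "x i \<noteq> 0" if "i \<in> {1..int m}" for i
    using ind that V.dependent_zero by (metis image_eqI)
  have inj': "inj_on ?e {- 1..int m}"
    using inj by (auto simp: inj_on_def ext_basis_def embed_def)
  have emb: "Vector_Spaces.linear scale (ext_scale scale) (embed :: 'v \<Rightarrow> 'v \<times> 'a \<times> 'a)"
    by unfold_locales (auto simp: embed_def ext_scale_def)
  have img: "?e ` {1..int m} = embed ` x ` {1..int m}"
    by (auto simp: ext_basis_def image_iff)
  have sub: "range embed \<subseteq> E.span (?e ` {- 1..int m})"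
  proof -
    have "range (embed :: 'v \<Rightarrow> 'v \<times> 'a \<times> 'a) = E.span (?e ` {1..int m})"
      unfolding img using module_hom.span_image[OF Vector_Spaces.linear.axioms(3)[OF emb]] sp by metis
    also have "\<dots> \<subseteq> E.span (?e ` {- 1..int m})" by (intro E.span_mono) auto
    finally show ?thesis .
  qed
  have span: "E.span (?e ` {- 1..int m}) = UNIV"
  proof (intro equalityI subset_UNIV subsetI)
    fix w :: "'v \<times> 'a \<times> 'a"
    obtain v a b where w: "w = (v, a, b)" by (cases w)
    have "w = embed v + ext_scale scale a (?e 0) + ext_scale scale b (?e (- 1))"
      by (simp add: w embed_def ext_scale_def ext_basis_def)
    moreover have "?e 0 \<in> E.span (?e ` {- 1..int m})" "?e (- 1) \<in> E.span (?e ` {- 1..int m})"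
      by (auto intro!: E.span_base imageI)
    ultimately show "w \<in> E.span (?e ` {- 1..int m})"
      using sub by (auto intro!: E.span_add E.span_scale)
  qed
  have "E.independent (?e ` {- 1..int m})"
  proof
    assume "E.dependent (?e ` {- 1..int m})"
    then obtain u j where j: "j \<in> {- 1..int m}" "u (?e j) \<noteq> 0"
      and z: "(\<Sum>w\<in>?e ` {- 1..int m}. ext_scale scale (u w) w) = 0"
      by (auto simp: E.dependent_finite)
    have z': "(\<Sum>i\<in>{- 1..int m}. ext_scale scale (u (?e i)) (?e i)) = 0"
      using z by (simp add: sum.reindex[OF inj'] o_def)
    have "ext_scale scale (u (?e (- 1))) (?e (- 1)) + ext_scale scale (u (?e 0)) (?e 0)
          + (\<Sum>i\<in>{1..int m}. ext_scale scale (u (?e i)) (?e i)) = 0"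
      using z' unfolding I by (subst (asm) sum.union_disjoint) (auto simp: add.assoc)
    moreover have "(\<Sum>i\<in>{1..int m}. ext_scale scale (u (?e i)) (?e i)) =
        embed (\<Sum>i\<in>{1..int m}. scale (u (?e i)) (x i))"
      by (simp add: module_hom.sum[OF Vector_Spaces.linear.axioms(3)[OF emb]])
         (auto intro!: sum.cong simp: ext_basis_def embed_def ext_scale_def)
    ultimately have c: "u (?e (- 1)) = 0" "u (?e 0) = 0"
        and s: "(\<Sum>i\<in>{1..int m}. scale (u (?e i)) (x i)) = 0"
      by (auto simp: ext_scale_def ext_basis_def embed_def zero_prod_def)
    define u' where "u' v = u (embed v)" for v
    have "(\<Sum>v\<in>x ` {1..int m}. scale (u' v) v) = 0"
      using s by (simp add: sum.reindex[OF inj] u'_def ext_basis_def)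
    then have "\<forall>v\<in>x ` {1..int m}. u' v = 0"
      using ind by (auto simp: V.dependent_finite)
    then have "u (?e i) = 0" if "i \<in> {1..int m}" for i
      using that by (auto simp: u'_def ext_basis_def)
    with c j I show False by auto
  qed
  with inj' span show ?thesis by (simp add: basis_family_def)
qed

end

theory Submission
  imports Defs
begin

text \<open>
  Write elements of the extension as \<open>(v, a, b)\<close>, meaning \<open>v + a x\<^sub>0 + b x\<^sub>-\<^sub>1\<close>. The prescribed values on
  basis tuples force the bracket of \<open>(v\<^sub>0, a\<^sub>0, b\<^sub>0), \<dots>, (v\<^sub>n, a\<^sub>n, b\<^sub>n)\<close> to be
  \<open>(\<Sum>\<^sub>k \<plusminus> a\<^sub>k \<mu>(v\<^sub>0,\<dots>,v\<^sub>k\<^sub>-\<^sub>1,v\<^sub>k\<^sub>+\<^sub>1,\<dots>,v\<^sub>n), 0, B(\<mu>(v\<^sub>0,\<dots>,v\<^sub>n\<^sub>-\<^sub>1), v\<^sub>n))\<close>, and all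
  identities are verified for this formula on arbitrary tuples, without reduction to basis vectors.

  The fundamental identity says that adjoint maps are derivations. An adjoint map of the extension
  sends \<open>(v, a, b)\<close> to \<open>(A v + a u, 0, B(M, v))\<close>, where \<open>A\<close> is a combination of adjoint maps of \<open>L\<close>,
  \<open>M\<close> is a bracket in \<open>L\<close> and \<open>u = \<plusminus>M\<close>. The part with \<open>A\<close> is harmless: \<open>A\<close> is a derivation of \<open>\<mu>\<close> and
  leaves \<open>B(\<mu>(\<dots>),\<dots>)\<close> invariant. The part with \<open>u\<close> produces terms with two coefficients \<open>a\<^sub>k a\<^sub>s\<close>; these
  are symmetric in \<open>k\<close> and \<open>s\<close>, while the vectors that they multiply are skew in \<open>k\<close> and \<open>s\<close>, so the sum
  vanishes (lemma \<open>sum_omit_update_cancel\<close>). What remains is an instance of the symmetry of \<open>B\<close>. See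
  \<open>ext_fundamental_identity\<close>.

  The coalgebra half needs no new computation. The dual of the extended cobracket is the same kind of
  extension, applied to \<open>L\<^sup>*\<close> with the bracket \<open>\<Delta>\<^sup>*\<close> and the form \<open>0\<close>, with \<open>x\<^sup>-\<^sup>1\<close> in the place of \<open>x\<^sub>0\<close>
  (\<open>ext_cobracket_eq\<close>), and a coalgebra identity is the fundamental identity of the dual bracket
  (\<open>co_identity_iff\<close>). Since \<open>n\<close>-Lie algebras live on types here and \<open>L\<^sup>*\<close> is only a set of functions,
  the bracket of \<open>L\<^sup>*\<close> is first pulled back to all functions along a linear projection onto \<open>L\<^sup>*\<close>.

  For compatibility, both sides are evaluated at functionals \<open>f\<^sub>0,\<dots>,f\<^sub>n\<close>. The form \<open>B\<close> enters through terms
  with a factor \<open>f\<^sub>j(x\<^sub>-\<^sub>1) f\<^sub>s(x\<^sub>-\<^sub>1)\<close>, which cancel by the same lemma. The rest is the compatibility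
  condition of \<open>L\<close>, summed over the entry that contributes \<open>x\<^sub>0\<close> and the functional that is paired with
  \<open>x\<^sub>-\<^sub>1\<close>; matching the two sides amounts to exchanging the order in which two entries are deleted
  (\<open>omit_omit\<close>).

  Finally, alternating maps are determined by their values on tuples of distinct basis vectors, so every
  pair of operations that meets the specification is the one constructed here.

  Positions are counted from 0 below: \<open>omit (Suc k)\<close> deletes the entry \<open>ys ! k\<close>.
\<close>

section \<open>Deleting entries of a tuple\<close>

lemma length_omit: "k < length xs \<Longrightarrow> length (omit (Suc k) xs) = length xs - 1"
  by (simp add: omit_def)

lemma nth_omit:
  assumes "k < length xs" "i < length xs - 1"
  shows "omit (Suc k) xs ! i = xs ! (if i < k then i else Suc i)"
  using assms by (auto simp: omit_def nth_append)

lemma map_omit: "map f (omit k xs) = omit k (map f xs)"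
  by (simp add: omit_def take_map drop_map)

lemma set_omit_subset: "set (omit k xs) \<subseteq> set xs"
  by (auto simp: omit_def dest: in_set_takeD in_set_dropD)

lemma omit_snoc: "k < length xs \<Longrightarrow> omit (Suc k) (xs @ [y]) = omit (Suc k) xs @ [y]"
  by (simp add: omit_def)

lemma omit_last: "omit (Suc (length xs)) (xs @ [y]) = xs"
  by (simp add: omit_def)

lemma omit_put_at:
  assumes "k \<le> length xs"
  shows "omit (Suc k) (put_at (Suc k) y xs) = xs"
  using assms by (simp add: omit_def put_at_def)

lemma length_put_at: "length (put_at k y xs) = Suc (length xs)"
  by (simp add: put_at_def)

lemma nth_put_at: "k \<le> length xs \<Longrightarrow> put_at (Suc k) y xs ! k = y"
  by (simp add: put_at_def nth_append)

lemma map_put_at: "map f (put_at k y xs) = put_at k (f y) (map f xs)"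
  by (simp add: put_at_def take_map drop_map)

lemma set_put_at: "set (put_at k y xs) = insert y (set xs)"
  by (metis Un_insert_right append_take_drop_id list.simps(15) put_at_def set_append)

lemma omit_update_same: "k < length xs \<Longrightarrow> omit (Suc k) (xs[k := y]) = omit (Suc k) xs"
  by (simp add: omit_def)

text \<open>
  After position \<open>k\<close> has been deleted, the entry formerly at position \<open>i \<noteq> k\<close> sits at position
  \<open>shift k i\<close>.
\<close>

definition shift :: "nat \<Rightarrow> nat \<Rightarrow> nat" where
  "shift k i = (if i < k then i else i - 1)"

lemma shift_less: "\<lbrakk>i \<le> n; k \<le> n; i \<noteq> k\<rbrakk> \<Longrightarrow> shift k i < n"
  by (auto simp: shift_def)

lemma nth_omit_shift:
  assumes "k < length xs" "i < length xs" "i \<noteq> k"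
  shows "omit (Suc k) xs ! shift k i = xs ! i"
  using assms by (auto simp: nth_omit shift_def)

lemma omit_update_other:
  assumes "k < length xs" "i < length xs" "i \<noteq> k"
  shows "omit (Suc k) (xs[i := y]) = (omit (Suc k) xs)[shift k i := y]"
proof (rule nth_equalityI)
  fix j assume "j < length (omit (Suc k) (xs[i := y]))"
  then have j: "j < length xs - 1" using assms by (simp add: length_omit)
  have "(shift k i = j) = (i = (if j < k then j else Suc j))"
    using assms(3) by (auto simp: shift_def)
  then show "omit (Suc k) (xs[i := y]) ! j = (omit (Suc k) xs)[shift k i := y] ! j"
    using assms j
    by (cases "shift k i = j") (auto simp: nth_omit length_omit)
qed (use assms in \<open>simp add: length_omit\<close>)

lemma omit_omit:
  assumes "k < length xs" "i < length xs" "i \<noteq> k"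
  shows "omit (Suc (shift k i)) (omit (Suc k) xs) = omit (Suc (shift i k)) (omit (Suc i) xs)"
proof (rule nth_equalityI)
  have "shift k i < length xs - 1" "shift i k < length xs - 1"
    using assms by (auto simp: shift_def)
  then show l: "length (omit (Suc (shift k i)) (omit (Suc k) xs)) =
      length (omit (Suc (shift i k)) (omit (Suc i) xs))"
    using assms by (simp add: length_omit)
  fix j assume "j < length (omit (Suc (shift k i)) (omit (Suc k) xs))"
  then have j: "j < length xs - 1 - 1" using assms \<open>shift k i < length xs - 1\<close>
    by (simp add: length_omit)
  have nth: "omit (Suc a) (omit (Suc b) xs) ! j =
      xs ! (let j' = if j < a then j else Suc j in if j' < b then j' else Suc j')"
    if "a < length xs - 1" "b < length xs" for a b
    using that j by (auto simp: nth_omit length_omit Let_def)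
  show "omit (Suc (shift k i)) (omit (Suc k) xs) ! j = omit (Suc (shift i k)) (omit (Suc i) xs) ! j"
    unfolding nth[OF \<open>shift k i < length xs - 1\<close> assms(1)]
      nth[OF \<open>shift i k < length xs - 1\<close> assms(2)]
    unfolding shift_def Let_def
    by (rule arg_cong[where f = "(!) xs"]) (use assms(3) in \<open>cases "i < k"; simp; linarith\<close>)
qed

lemma bij_betw_shift:
  assumes "k \<le> n"
  shows "bij_betw (shift k) ({..n} - {k}) {..<n}"
  proof (rule bij_betwI[where g = "\<lambda>i. if i < k then i else Suc i"])
  show "shift k \<in> {..n} - {k} \<rightarrow> {..<n}"
    using assms by (intro Pi_I) (auto simp: shift_less)
qed (use assms in \<open>auto simp: shift_def\<close>)

lemma sum_shift: "k \<le> n \<Longrightarrow> (\<Sum>i<n. f i) = (\<Sum>i\<in>{..n} - {k}. f (shift k i))"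
  using sum.reindex_bij_betw[OF bij_betw_shift, of k n f] by simp

lemma sum_off_diagonal_swap:
  "(\<Sum>s\<le>n. \<Sum>k\<in>{..n} - {s}. t s k) = (\<Sum>k\<le>n. \<Sum>s\<in>{..n} - {k}. t s k)"
  for n :: nat
proof -
  have "(\<Sum>s\<le>n. \<Sum>k\<in>{..n} - {s}. t s k) = (\<Sum>s\<le>n. \<Sum>k | k \<in> {..n} \<and> k \<noteq> s. t s k)"
    by (intro sum.cong) auto
  also have "\<dots> = (\<Sum>k\<le>n. \<Sum>s | s \<in> {..n} \<and> k \<noteq> s. t s k)"
    by (rule sum.swap_restrict) auto
  also have "\<dots> = (\<Sum>k\<le>n. \<Sum>s\<in>{..n} - {k}. t s k)"
    by (intro sum.cong) auto
  finally show ?thesis .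
qed

lemma sum_one_based: "(\<Sum>s = 1..n. f s) = (\<Sum>s<n. f (Suc s))"
proof -
  have "{1..n} = Suc ` {..<n}" by (auto simp: image_iff lessThan_atLeast0 Suc_le_eq gr0_conv_Suc)
  then show ?thesis by (simp add: sum.reindex)
qed

text \<open>
  Exactly one of the two entries is moved by the deletion of the other one, namely the later one, and
  it moves by one position. Hence the two orders of deletion give opposite signs.
\<close>

lemma power_shift_swap:
  assumes "i \<noteq> k"
  shows "(- 1 :: 'a::ring_1) ^ (k + shift k i) = - ((- 1) ^ (i + shift i k))"
proof (cases "i < k")
  case True
  then obtain k' where "k = Suc k'" by (cases k) auto
  with True show ?thesis by (simp add: shift_def add.commute)
next
  case False
  with assms obtain i' where "i = Suc i'" by (cases i) auto
  with False assms have "\<not> i < k" "k < i" by auto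
  with \<open>i = Suc i'\<close> show ?thesis by (simp add: shift_def add.commute)
qed

section \<open>Multilinear and alternating maps\<close>

text \<open>
  Multiplication by 2 is injective in characteristic zero. Hence a skew-symmetric map vanishes on tuples
  with a repeated entry.
\<close>

lemma eq_neg_imp_zero:
  fixes scale :: "'a::field_char_0 \<Rightarrow> 'v::ab_group_add \<Rightarrow> 'v" and v :: 'v
  assumes "vector_space scale" "v = - v"
  shows "v = 0"
proof -
  interpret vector_space scale by fact
  have "scale (1 + 1) v = 0"
    by (subst scale_left_distrib) (use assms(2) in \<open>simp add: eq_neg_iff_add_eq_0\<close>)
  then show ?thesis by (metis scale_eq_0_iff one_add_one zero_neq_numeral)
qed

locale multilinear = V: vector_space scaleV + W: vector_space scaleW
  for scaleV :: "'a::field_char_0 \<Rightarrow> 'v::ab_group_add \<Rightarrow> 'v"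
    and scaleW :: "'a \<Rightarrow> 'w::ab_group_add \<Rightarrow> 'w"
    and n :: nat and f :: "'v list \<Rightarrow> 'w" +
  assumes multilinear: "multilinear_map scaleV scaleW n f"
begin

lemma linear_entry: "length vs = n \<Longrightarrow> i < n \<Longrightarrow> Vector_Spaces.linear scaleV scaleW (\<lambda>v. f (vs[i := v]))"
  using multilinear by (auto simp: multilinear_map_def)

lemma add_entry:
  "length vs = n \<Longrightarrow> i < n \<Longrightarrow> f (vs[i := u + v]) = f (vs[i := u]) + f (vs[i := v])"
  using linear_entry by (simp add: Vector_Spaces.linear_iff)

lemma scale_entry:
  "length vs = n \<Longrightarrow> i < n \<Longrightarrow> f (vs[i := scaleV c v]) = scaleW c (f (vs[i := v]))"
  using linear_entry by (simp add: Vector_Spaces.linear_iff)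

lemma zero_entry: "length vs = n \<Longrightarrow> i < n \<Longrightarrow> f (vs[i := 0]) = 0"
  using scale_entry[of vs i 0 0] by simp

lemma sum_entry:
  assumes "length vs = n" "i < n"
  shows "f (vs[i := (\<Sum>j\<in>J. g j)]) = (\<Sum>j\<in>J. f (vs[i := g j]))"
proof -
  interpret l: Vector_Spaces.linear scaleV scaleW "\<lambda>v. f (vs[i := v])"
    using linear_entry assms .
  show ?thesis by (rule l.sum)
qed

lemma zero_in_set:
  assumes "length vs = n" "0 \<in> set vs"
  shows "f vs = 0"
  using assms zero_entry[of vs] by (metis in_set_conv_nth list_update_id)

lemma linear_snoc: "Suc (length vs) = n \<Longrightarrow> Vector_Spaces.linear scaleV scaleW (\<lambda>v. f (vs @ [v]))"
  using linear_entry[of "vs @ [0]" "length vs"] by simp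

end

locale alternating_map = multilinear scaleV scaleW n f
  for scaleV :: "'a::field_char_0 \<Rightarrow> 'v::ab_group_add \<Rightarrow> 'v"
    and scaleW :: "'a \<Rightarrow> 'w::ab_group_add \<Rightarrow> 'w"
    and n :: nat and f :: "'v list \<Rightarrow> 'w" +
  assumes permute: "\<lbrakk>\<sigma> permutes {..<n}; length vs = n\<rbrakk> \<Longrightarrow>
    f vs = scaleW (of_int (sign \<sigma>)) (f (permute_list \<sigma> vs))"

lemma alternating_map_iff:
  "alternating_map scaleV scaleW n f \<longleftrightarrow>
    vector_space scaleV \<and> vector_space scaleW \<and> alternating_multilinear scaleV scaleW n f"
  for scaleV :: "'a::field_char_0 \<Rightarrow> 'v::ab_group_add \<Rightarrow> 'v"
  by (auto simp: alternating_map_def alternating_map_axioms_def multilinear_def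
      multilinear_axioms_def alternating_multilinear_def)

lemma permute_list_transpose:
  assumes "i < length vs" "j < length vs"
  shows "permute_list (transpose i j) vs = vs[i := vs ! j, j := vs ! i]"
  using assms by (intro nth_equalityI) (auto simp: permute_list_def nth_list_update transpose_def)

context alternating_map
begin

lemma swap:
  assumes "length vs = n" "i < n" "j < n" "i \<noteq> j"
  shows "f (vs[i := vs ! j, j := vs ! i]) = - f vs"
proof -
  have "f vs = scaleW (of_int (sign (transpose i j))) (f (permute_list (transpose i j) vs))"
    using assms by (intro permute permutes_swap_id) auto
  with assms show ?thesis by (simp add: sign_swap_id permute_list_transpose)
qed

lemma repeated_entry:
  assumes "length vs = n" "i < n" "j < n" "i \<noteq> j" "vs ! i = vs ! j"
  shows "f vs = 0"
proof -
  have "vs[i := vs ! j, j := vs ! i] = vs"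
    using assms by (metis list_update_id)
  then have "f vs = - f vs" using swap[OF assms(1-4)] by simp
  then show ?thesis by (rule eq_neg_imp_zero[OF W.vector_space_axioms])
qed

lemma not_distinct: "length vs = n \<Longrightarrow> \<not> distinct vs \<Longrightarrow> f vs = 0"
  by (metis distinct_conv_nth repeated_entry)

text \<open>
  The sign is that of a cycle, obtained as a product of adjacent transpositions.
\<close>

lemma move_to_end:
  "length (xs @ z # ys) = n \<Longrightarrow> f (xs @ z # ys) = scaleW ((- 1) ^ length ys) (f (xs @ ys @ [z]))"
proof (induction ys arbitrary: xs)
  case (Cons y ys)
  have "f (xs @ y # z # ys) = - f (xs @ z # y # ys)"
    using swap[of "xs @ z # y # ys" "length xs" "Suc (length xs)"] Cons.prems
    by (simp add: nth_append list_update_append)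
  moreover have "f ((xs @ [y]) @ z # ys) = scaleW ((- 1) ^ length ys) (f ((xs @ [y]) @ ys @ [z]))"
    using Cons.prems by (intro Cons.IH) simp
  ultimately have "- f (xs @ z # y # ys) = scaleW ((- 1) ^ length ys) (f (xs @ y # ys @ [z]))"
    by simp
  then have "f (xs @ z # y # ys) = - scaleW ((- 1) ^ length ys) (f (xs @ y # ys @ [z]))"
    by (metis minus_minus)
  then show ?case by simp
qed simp

lemma update_eq_snoc:
  assumes "length ys = n" "s < n"
  shows "f (ys[s := z]) = scaleW ((- 1) ^ (n - Suc s)) (f (omit (Suc s) ys @ [z]))"
  using assms move_to_end[of "take s ys" z "drop (Suc s) ys"]
  by (simp add: upd_conv_take_nth_drop omit_def)

lemma snoc_eq_update:
  assumes "length ys = n" "s < n"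
  shows "f (omit (Suc s) ys @ [z]) = scaleW ((- 1) ^ (n - Suc s)) (f (ys[s := z]))"
proof -
  have "(- 1 :: 'a) ^ (n - Suc s) * (- 1) ^ (n - Suc s) = 1"
    by (simp flip: power_mult_distrib)
  then show ?thesis unfolding update_eq_snoc[OF assms] by simp
qed

text \<open>
  Deleting \<open>k\<close> and writing \<open>u\<close> at \<open>s\<close>, or deleting \<open>s\<close> and writing \<open>u\<close> at \<open>k\<close>, leaves the same
  entries; moving \<open>u\<close> to the end in both cases determines the relative sign.
\<close>

lemma omit_update_swap:
  assumes "length vs = Suc n" "k \<le> n" "s \<le> n" "k \<noteq> s"
  shows "scaleW ((- 1) ^ k) (f (omit (Suc k) (vs[s := u]))) =
    - scaleW ((- 1) ^ s) (f (omit (Suc s) (vs[k := u])))"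
proof -
  have *: "scaleW ((- 1) ^ k) (f (omit (Suc k) (vs[s := u]))) =
      scaleW ((- 1) ^ (n + 1 + (k + shift k s))) (f (omit (Suc (shift k s)) (omit (Suc k) vs) @ [u]))"
    if "k \<le> n" "s \<le> n" "k \<noteq> s" for k s
  proof -
    have lt: "shift k s < n" using that by (auto simp: shift_def)
    have "(- 1 :: 'a) ^ k * (- 1) ^ (n - Suc (shift k s)) = (- 1) ^ (n + 1 + (k + shift k s))"
    proof -
      have "(- 1 :: 'a) ^ (n + 1 + (k + shift k s)) =
          (- 1) ^ (k + (n - Suc (shift k s)) + 2 * (1 + shift k s))"
        using lt by (intro arg_cong[where f = "\<lambda>e. (- 1 :: 'a) ^ e"]) simp
      then show ?thesis by (simp add: power_add power_mult)
    qed
    then show ?thesis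
      using that assms lt by (simp add: omit_update_other update_eq_snoc length_omit)
  qed
  have "(- 1 :: 'a) ^ (n + 1 + (k + shift k s)) = - ((- 1) ^ (n + 1 + (s + shift s k)))"
    unfolding power_add[of _ "n + 1"] power_shift_swap[OF assms(4)[symmetric]] by simp
  moreover have "omit (Suc (shift k s)) (omit (Suc k) vs) = omit (Suc (shift s k)) (omit (Suc s) vs)"
    using assms by (intro omit_omit) auto
  ultimately show ?thesis
    unfolding *[OF assms(2-4)] *[OF assms(3,2) assms(4)[symmetric]] by simp
qed

text \<open>
  The double sum vanishes because the transposed terms cancel: the coefficient \<open>a\<^sub>k a\<^sub>s\<close> is
  symmetric, the rest is skew-symmetric by the preceding lemma.
\<close>

lemma sum_omit_update_cancel:
  assumes "length vs = Suc n"
  shows "(\<Sum>s\<le>n. \<Sum>k\<in>{..n} - {s}. scaleW ((- 1) ^ k * a k * a s) (f (omit (Suc k) (vs[s := u])))) = 0"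
    (is "?S = 0")
proof -
  let ?t = "\<lambda>s k. scaleW ((- 1) ^ k * a k * a s) (f (omit (Suc k) (vs[s := u])))"
  have skew: "?t s k = - ?t k s" if "s \<le> n" "k \<le> n" "k \<noteq> s" for s k
    using arg_cong[OF omit_update_swap[OF assms that(2,1,3), of u], of "scaleW (a k * a s)"]
    by (simp add: mult_ac)
  have "?S = (\<Sum>s\<le>n. \<Sum>k\<in>{..n} - {s}. - ?t k s)"
    by (intro sum.cong refl skew) auto
  also have "\<dots> = - (\<Sum>s\<le>n. \<Sum>k\<in>{..n} - {s}. ?t k s)" by (simp only: sum_negf)
  also have "(\<Sum>s\<le>n. \<Sum>k\<in>{..n} - {s}. ?t k s) = ?S"
    by (rule sum_off_diagonal_swap)
  finally show "?S = 0" by (rule eq_neg_imp_zero[OF W.vector_space_axioms])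
qed

end

text \<open>
  Polarisation of \<open>f(\<dots>,u + v,\<dots>,u + v,\<dots>) = 0\<close> gives the sign of a transposition, and transpositions
  generate the symmetric group. This reduces skew-symmetry of the extended bracket to tuples with two
  equal entries.
\<close>

lemma (in multilinear) alternatingI:
  assumes zero: "\<And>vs i j. \<lbrakk>length vs = n; i < j; j < n; vs ! i = vs ! j\<rbrakk> \<Longrightarrow> f vs = 0"
  shows "alternating_map scaleV scaleW n f"
proof
  have transp: "f (vs[i := vs ! j, j := vs ! i]) = - f vs"
    if len: "length vs = n" and ij: "i < n" "j < n" "i \<noteq> j" for vs i j
  proof -
    let ?F = "\<lambda>u v. f (vs[i := u, j := v])"
    have z: "?F u u = 0" for u
      using zero[of "vs[i := u, j := u]" "min i j" "max i j"] len ij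
      by (auto simp: min_def max_def nth_list_update split: if_splits)
    have swp: "vs[i := u, j := v] = vs[j := v, i := u]" for u v
      using ij by (simp add: list_update_swap)
    have addr: "?F u (v + w) = ?F u v + ?F u w" for u v w
      using len ij by (simp add: add_entry)
    have addl: "?F (v + w) u = ?F v u + ?F w u" for u v w
      using len ij by (simp add: add_entry swp)
    define a b where "a = vs ! i" and "b = vs ! j"
    have "0 = ?F (a + b) (a + b)" by (rule z[symmetric])
    also have "\<dots> = ?F a (a + b) + ?F b (a + b)" by (rule addl)
    also have "?F a (a + b) = ?F a a + ?F a b" by (rule addr)
    also have "?F b (a + b) = ?F b a + ?F b b" by (rule addr)
    finally have "?F a b + ?F b a = 0" unfolding z by simp
    moreover have "?F a b = f vs" unfolding a_def b_def by simp
    ultimately have "f vs + ?F b a = 0" by simp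
    then have "- f vs = ?F b a" by (rule minus_unique)
    then show ?thesis unfolding a_def b_def by simp
  qed
  fix \<sigma> :: "nat \<Rightarrow> nat" and vs :: "'v list"
  assume "\<sigma> permutes {..<n}" and len: "length vs = n"
  show "f vs = scaleW (of_int (sign \<sigma>)) (f (permute_list \<sigma> vs))"
    using finite_lessThan[of n] \<open>\<sigma> permutes {..<n}\<close>
  proof (induction \<sigma> rule: permutes_rev_induct)
    case (swap a b p)
    let ?us = "permute_list p vs"
    have ab: "a < n" "b < n" "a \<noteq> b" and lu: "length ?us = n" using swap.hyps len by auto
    have "permute_list (p \<circ> transpose a b) vs = permute_list (transpose a b) ?us"
      using ab len by (intro permute_list_compose permutes_swap_id) auto
    also have "\<dots> = ?us[a := ?us ! b, b := ?us ! a]"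
      using ab lu by (intro permute_list_transpose) auto
    finally have "f (permute_list (p \<circ> transpose a b) vs) = - f ?us"
      using transp[OF lu ab] by simp
    moreover have "sign (p \<circ> transpose a b) = - sign p"
      using sign_compose[OF permutes_imp_permutation[OF finite_lessThan swap.hyps(4)]
          permutation_swap_id, of a b] ab by (simp add: sign_swap_id)
    moreover note swap.IH
    ultimately show ?case by (metis W.scale_minus_left W.scale_minus_right minus_minus of_int_minus)
  qed simp
qed

section \<open>The extended bracket\<close>

text \<open>
  The right-hand side of the fundamental identity, with each inner bracket moved back to the place of
  the entry it replaces. In this form, without signs, the identity says that \<open>g\<close> is a derivation.
\<close>

lemma (in alternating_map) sum_snoc_eq_sum_update:
  assumes "length ys = n"
  shows "(\<Sum>s = 1..n. scaleW ((- 1) ^ (n - s)) (f (omit s ys @ [g (ys ! (s - 1))]))) =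
    (\<Sum>s<n. f (ys[s := g (ys ! s)]))"
  unfolding sum_one_based
proof (rule sum.cong)
  fix s assume "s \<in> {..<n}"
  then have s: "s < n" by simp
  have "(- 1 :: 'a) ^ (n - Suc s) * (- 1) ^ (n - Suc s) = 1"
    by (simp flip: power_mult_distrib)
  then show "scaleW ((- 1) ^ (n - Suc s)) (f (omit (Suc s) ys @ [g (ys ! (Suc s - 1))])) =
      f (ys[s := g (ys ! s)])"
    unfolding snoc_eq_update[OF assms s] by simp
qed simp

lemma vector_space_field: "vector_space ((*) :: 'a::field \<Rightarrow> 'a \<Rightarrow> 'a)"
  by unfold_locales (auto simp: algebra_simps)

lemma sum_prod_triple: "(\<Sum>j\<in>J. (f j, g j, h j)) = (sum f J, sum g J, sum h J)"
  by (induction J rule: infinite_finite_induct) (auto simp: zero_prod_def)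

text \<open>
  An element \<open>(v, a, b)\<close> of the extension stands for \<open>v + a x\<^sub>0 + b x\<^sub>-\<^sub>1\<close>. Expanding each entry of a tuple
  in this way, only the terms with exactly one \<open>x\<^sub>0\<close> or with entries from \<open>L\<close> alone survive, which gives
  the following closed form of the bracket; the sum runs over the position of \<open>x\<^sub>0\<close>.
\<close>

definition ext_bracket ::
  "('a::field \<Rightarrow> 'v::ab_group_add \<Rightarrow> 'v) \<Rightarrow> nat \<Rightarrow> ('v list \<Rightarrow> 'v) \<Rightarrow> ('v \<Rightarrow> 'v \<Rightarrow> 'a)
     \<Rightarrow> ('v \<times> 'a \<times> 'a) list \<Rightarrow> 'v \<times> 'a \<times> 'a" where
  "ext_bracket scale n \<mu> B ws =
     (\<Sum>k\<le>n. scale ((- 1) ^ k * fst (snd (ws ! k))) (\<mu> (omit (Suc k) (map fst ws))),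
      0,
      B (\<mu> (take n (map fst ws))) (fst (ws ! n)))"

locale n_lie_algebra_with_form = n_lie_algebra scale n \<mu>
  for scale :: "'a::field_char_0 \<Rightarrow> 'v::ab_group_add \<Rightarrow> 'v"
    and n :: nat and \<mu> :: "'v list \<Rightarrow> 'v" +
  fixes B :: "'v \<Rightarrow> 'v \<Rightarrow> 'a"
  assumes arity_pos: "n > 0"
    and form_linear: "Vector_Spaces.linear scale (*) (B y)"
    and form_symmetric: "B y z = B z y"
    and form_invariant: "length ys = n - 1 \<Longrightarrow> B (\<mu> (ys @ [y])) z + B y (\<mu> (ys @ [z])) = 0"
begin

sublocale bracket: alternating_map scale scale n \<mu>
  unfolding alternating_map_iff using vector_space_axioms alternating by simp

sublocale ext: vector_space "ext_scale scale"
  by (rule vector_space_ext_scale)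

abbreviation ext_mu :: "('v \<times> 'a \<times> 'a) list \<Rightarrow> 'v \<times> 'a \<times> 'a" where
  "ext_mu \<equiv> ext_bracket scale n \<mu> B"

abbreviation form3 :: "'v list \<Rightarrow> 'a" where
  "form3 vs \<equiv> B (\<mu> (take n vs)) (vs ! n)"

lemma form_linear_left: "Vector_Spaces.linear scale (*) (\<lambda>y. B y z)"
  using form_linear[of z] by (subst form_symmetric)

lemma form_scale: "B y (scale c v) = c * B y v" "B (scale c v) y = c * B v y"
  using form_linear form_linear_left by (auto simp: Vector_Spaces.linear_iff)

lemma form_zero: "B y 0 = 0" "B 0 y = 0"
  using form_scale(1)[of y 0 0] form_scale(2)[of 0 0 y] by auto

lemma form_sum: "B y (\<Sum>j\<in>J. g j) = (\<Sum>j\<in>J. B y (g j))" "B (\<Sum>j\<in>J. g j) y = (\<Sum>j\<in>J. B (g j) y)"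
proof -
  interpret l: Vector_Spaces.linear scale "(*)" "B y" by (rule form_linear)
  interpret r: Vector_Spaces.linear scale "(*)" "\<lambda>z. B z y" by (rule form_linear_left)
  show "B y (\<Sum>j\<in>J. g j) = (\<Sum>j\<in>J. B y (g j))" "B (\<Sum>j\<in>J. g j) y = (\<Sum>j\<in>J. B (g j) y)"
    by (rule l.sum, rule r.sum)
qed

text \<open>
  Invariance and symmetry of \<open>B\<close> make \<open>B(\<mu>(v\<^sub>1,\<dots>,v\<^sub>n), v\<^sub>n\<^sub>+\<^sub>1)\<close> skew-symmetric in all arguments: if an entry
  \<open>v\<close> among the first \<open>n\<close> equals the last one, it can be moved to the end of \<open>\<mu>\<close>, and invariance
  gives \<open>2 B(\<mu>(\<dots>,v), v) = 0\<close>.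
\<close>

sublocale form3: alternating_map scale "(*)" "Suc n" form3
proof -
  interpret F: vector_space "(*) :: 'a \<Rightarrow> 'a \<Rightarrow> 'a" by (rule vector_space_field)
  interpret m: multilinear scale "(*)" "Suc n" form3
  proof
    show "multilinear_map scale (*) (Suc n) form3"
      unfolding multilinear_map_def
    proof (intro allI impI)
      fix vs :: "'v list" and i
      assume len: "length vs = Suc n" and i: "i < Suc n"
      show "Vector_Spaces.linear scale (*) (\<lambda>v. form3 (vs[i := v]))"
      proof (cases "i = n")
        case True
        then show ?thesis using form_linear len by simp
      next
        case False
        with i have "i < n" by simp
        then have "Vector_Spaces.linear scale scale (\<lambda>v. \<mu> ((take n vs)[i := v]))"
          using len by (intro bracket.linear_entry) auto
        from Vector_Spaces.linear_compose[OF this form_linear_left[of "vs ! n"]]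
        show ?thesis using \<open>i < n\<close> len by (simp add: o_def take_update_swap)
      qed
    qed
  qed
  show "alternating_map scale (*) (Suc n) form3"
  proof (rule m.alternatingI)
    fix vs :: "'v list" and i j
    assume len: "length vs = Suc n" and ij: "i < j" "j < Suc n" and eq: "vs ! i = vs ! j"
    show "form3 vs = 0"
    proof (cases "j = n")
      case False
      then have "\<mu> (take n vs) = 0"
        using len ij eq by (intro bracket.repeated_entry[of _ i j]) auto
      then show ?thesis by (simp add: form_zero)
    next
      case True
      let ?us = "take n vs" and ?v = "vs ! n"
      have i: "i < n" and lu: "length ?us = n" using ij True len by auto
      have "?us ! i = ?v" using i eq True by simp
      then have "?us[i := ?v] = ?us" by (metis list_update_id)
      then have "\<mu> ?us = scale ((- 1) ^ (n - Suc i)) (\<mu> (omit (Suc i) ?us @ [?v]))"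
        using bracket.update_eq_snoc[OF lu i, of ?v] by simp
      moreover have "B (\<mu> (omit (Suc i) ?us @ [?v])) ?v = 0"
        using form_invariant[of "omit (Suc i) ?us" ?v ?v] i lu
        by (simp add: length_omit form_symmetric[of ?v])
      ultimately show ?thesis by (simp add: form_scale)
    qed
  qed
qed

sublocale ext_multilinear: multilinear "ext_scale scale" "ext_scale scale" "Suc n" ext_mu
proof
  show "multilinear_map (ext_scale scale) (ext_scale scale) (Suc n) ext_mu"
    unfolding multilinear_map_def
  proof (intro allI impI)
    fix ws :: "('v \<times> 'a \<times> 'a) list" and i
    assume len: "length ws = Suc n" and i: "i < Suc n"
    let ?vs = "map fst ws"
    let ?t = "\<lambda>w k. scale ((- 1) ^ k * fst (snd (ws[i := w] ! k))) (\<mu> (omit (Suc k) (?vs[i := fst w])))"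
    have ext: "ext_mu (ws[i := w]) = (\<Sum>k\<le>n. ?t w k, 0, form3 (?vs[i := fst w]))" for w
      using len by (simp add: ext_bracket_def map_update flip: nth_map[where f = fst])
    have same: "?t w i = scale ((- 1) ^ i * fst (snd w)) (\<mu> (omit (Suc i) ?vs))" for w
      using len i by (simp add: omit_update_same)
    have other: "?t w k = scale ((- 1) ^ k * fst (snd (ws ! k))) (\<mu> ((omit (Suc k) ?vs)[shift k i := fst w]))"
      if "k \<le> n" "k \<noteq> i" for w k
      using len i that by (simp add: omit_update_other)
    have lo: "length (omit (Suc k) ?vs) = n" "shift k i < n" if "k \<le> n" "k \<noteq> i" for k
      using len i that by (auto simp: length_omit shift_less)
    have add: "?t (u + v) k = ?t u k + ?t v k" if "k \<le> n" for u v k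
    proof (cases "k = i")
      case True
      show ?thesis unfolding True same by (simp add: distrib_left scale_left_distrib)
    next
      case False
      have "?t (u + v) k =
          scale ((- 1) ^ k * fst (snd (ws ! k))) (\<mu> ((omit (Suc k) ?vs)[shift k i := fst (u + v)]))"
        by (rule other[OF that False])
      then show ?thesis unfolding other[OF that False]
        using lo[OF that False] by (simp add: bracket.add_entry scale_right_distrib)
    qed
    have scl: "?t (ext_scale scale c v) k = scale c (?t v k)" if "k \<le> n" for c v k
    proof (cases "k = i")
      case True
      show ?thesis unfolding True same
        by (simp only: ext_scale_def fst_conv snd_conv scale_scale mult.left_commute[of _ c])
    next
      case False
      have "?t (ext_scale scale c v) k = scale ((- 1) ^ k * fst (snd (ws ! k)))
          (\<mu> ((omit (Suc k) ?vs)[shift k i := fst (ext_scale scale c v)]))"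
        by (rule other[OF that False])
      then show ?thesis unfolding other[OF that False]
        using lo[OF that False]
        by (simp only: ext_scale_def fst_conv bracket.scale_entry scale_left_commute[of _ c])
    qed
    have sum_add: "(\<Sum>k\<le>n. ?t (u + v) k) = (\<Sum>k\<le>n. ?t u k) + (\<Sum>k\<le>n. ?t v k)" for u v
      unfolding sum.distrib[symmetric] by (intro sum.cong refl add) simp
    have sum_scl: "(\<Sum>k\<le>n. ?t (ext_scale scale c v) k) = scale c (\<Sum>k\<le>n. ?t v k)" for c v
      unfolding scale_sum_right by (intro sum.cong refl scl) simp
    show "Vector_Spaces.linear (ext_scale scale) (ext_scale scale) (\<lambda>w. ext_mu (ws[i := w]))"
      unfolding Vector_Spaces.linear_iff
    proof (intro conjI allI ext.vector_space_axioms)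
      fix u v
      show "ext_mu (ws[i := u + v]) = ext_mu (ws[i := u]) + ext_mu (ws[i := v])"
        using len i form3.add_entry[of ?vs i "fst u" "fst v"]
        unfolding ext sum_add sum_scl by simp
    next
      fix c v
      show "ext_mu (ws[i := ext_scale scale c v]) = ext_scale scale c (ext_mu (ws[i := v]))"
        using len i form3.scale_entry[of ?vs i c "fst v"]
        unfolding ext sum_scl by (simp add: ext_scale_def)
    qed
  qed
qed


lemma ext_mu_eq:
  assumes "length ws = Suc n"
  shows "ext_mu ws = (\<Sum>k\<le>n. scale ((- 1) ^ k * fst (snd (ws ! k))) (\<mu> (omit (Suc k) (map fst ws))),
    0, form3 (map fst ws))"
  using assms by (simp add: ext_bracket_def)

text \<open>
  If entries \<open>i\<close> and \<open>j\<close> agree, deleting any other entry leaves a tuple with a repetition. The two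
  remaining terms delete one of the two equal entries and have opposite signs.
\<close>

sublocale ext_bracket: alternating_map "ext_scale scale" "ext_scale scale" "Suc n" ext_mu
proof (rule ext_multilinear.alternatingI)
  fix ws :: "('v \<times> 'a \<times> 'a) list" and i j
  assume len: "length ws = Suc n" and ij: "i < j" "j < Suc n" and eq: "ws ! i = ws ! j"
  let ?vs = "map fst ws"
  let ?t = "\<lambda>k. scale ((- 1) ^ k * fst (snd (ws ! k))) (\<mu> (omit (Suc k) ?vs))"
  have veq: "?vs ! i = ?vs ! j" using len ij eq by simp
  have "?t k = 0" if k: "k \<le> n" "k \<noteq> i" "k \<noteq> j" for k
  proof -
    have s: "shift k i < n" "shift k j < n" "shift k i \<noteq> shift k j"
      using k ij by (auto simp: shift_def)
    have "omit (Suc k) ?vs ! shift k i = omit (Suc k) ?vs ! shift k j"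
      using len k ij veq by (simp only: nth_omit_shift length_map)
    then have "\<mu> (omit (Suc k) ?vs) = 0"
      using len k s by (intro bracket.repeated_entry[of _ "shift k i" "shift k j"]) (auto simp: length_omit)
    then show ?thesis by simp
  qed
  then have "(\<Sum>k\<le>n. ?t k) = (\<Sum>k\<in>{i, j}. ?t k)"
    using ij by (intro sum.mono_neutral_right) auto
  also have "\<dots> = scale (fst (snd (ws ! j))) (scale ((- 1) ^ i) (\<mu> (omit (Suc i) ?vs)) +
      scale ((- 1) ^ j) (\<mu> (omit (Suc j) ?vs)))"
    using ij eq by (simp add: mult.commute scale_right_distrib)
  also have "scale ((- 1) ^ i) (\<mu> (omit (Suc i) ?vs)) = - scale ((- 1) ^ j) (\<mu> (omit (Suc j) ?vs))"
  proof -
    have "?vs[j := ?vs ! j] = ?vs" "?vs[i := ?vs ! j] = ?vs"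
      by (rule list_update_id) (metis veq list_update_id)
    then show ?thesis
      using bracket.omit_update_swap[of ?vs i j "?vs ! j"] len ij by simp
  qed
  finally have "(\<Sum>k\<le>n. ?t k) = 0" by simp
  moreover have "form3 ?vs = 0"
    using len ij veq by (intro form3.repeated_entry[of _ i j]) auto
  ultimately show "ext_mu ws = 0" by (simp add: ext_mu_eq[OF len] zero_prod_def)
qed

text \<open>
  The part of the adjoint action of \<open>xs\<close> that maps \<open>L\<close> to \<open>L\<close>: a linear combination of adjoint maps of
  \<open>L\<close>, hence a derivation of \<open>\<mu>\<close> that is skew with respect to \<open>B\<close>.
\<close>

definition ad_coeff :: "('v \<times> 'a \<times> 'a) list \<Rightarrow> 'v \<Rightarrow> 'v" where
  "ad_coeff xs v = (\<Sum>k<n. scale ((- 1) ^ k * fst (snd (xs ! k))) (\<mu> (omit (Suc k) (map fst xs) @ [v])))"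

lemma ext_mu_snoc:
  assumes "length xs = n"
  shows "ext_mu (xs @ [w]) =
    (ad_coeff xs (fst w) + scale (fst (snd w)) (scale ((- 1) ^ n) (\<mu> (map fst xs))),
     0, B (\<mu> (map fst xs)) (fst w))"
proof -
  have "(\<Sum>k\<le>n. scale ((- 1) ^ k * fst (snd ((xs @ [w]) ! k))) (\<mu> (omit (Suc k) (map fst (xs @ [w]))))) =
      (\<Sum>k<n. scale ((- 1) ^ k * fst (snd ((xs @ [w]) ! k))) (\<mu> (omit (Suc k) (map fst (xs @ [w]))))) +
      scale ((- 1) ^ n * fst (snd w)) (\<mu> (map fst xs))"
    using assms omit_last[of "map fst xs" "fst w"]
    by (simp add: lessThan_Suc_atMost[symmetric] nth_append)
  also have "(\<Sum>k<n. scale ((- 1) ^ k * fst (snd ((xs @ [w]) ! k))) (\<mu> (omit (Suc k) (map fst (xs @ [w]))))) =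
      ad_coeff xs (fst w)"
    unfolding ad_coeff_def using assms
    by (intro sum.cong) (simp_all add: nth_append omit_snoc)
  finally show ?thesis using assms by (simp add: ext_mu_eq nth_append mult.commute)
qed

lemma derivation_ad:
  assumes "length xs = n - 1" "length ys = n"
  shows "\<mu> (xs @ [\<mu> ys]) = (\<Sum>s<n. \<mu> (ys[s := \<mu> (xs @ [ys ! s])]))"
  using fundamental_identity[OF assms] bracket.sum_snoc_eq_sum_update[OF assms(2)] by simp

lemma linear_ad: "length xs = n - 1 \<Longrightarrow> Vector_Spaces.linear scale scale (\<lambda>v. \<mu> (xs @ [v]))"
  using bracket.linear_snoc[of xs] arity_pos by simp

context
  fixes xs :: "('v \<times> 'a \<times> 'a) list"
  assumes length_xs: "length xs = n"
begin

lemma length_omit_fst: "k < n \<Longrightarrow> length (omit (Suc k) (map fst xs)) = n - 1"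
  using length_xs by (simp add: length_omit)

lemma linear_ad_coeff: "Vector_Spaces.linear scale scale (ad_coeff xs)"
proof -
  note lin = linear_ad[OF length_omit_fst, unfolded Vector_Spaces.linear_iff]
  show ?thesis
    unfolding Vector_Spaces.linear_iff ad_coeff_def
  proof (intro conjI allI vector_space_axioms)
    fix u v c
    show "(\<Sum>k<n. scale ((- 1) ^ k * fst (snd (xs ! k))) (\<mu> (omit (Suc k) (map fst xs) @ [u + v]))) =
        (\<Sum>k<n. scale ((- 1) ^ k * fst (snd (xs ! k))) (\<mu> (omit (Suc k) (map fst xs) @ [u]))) +
        (\<Sum>k<n. scale ((- 1) ^ k * fst (snd (xs ! k))) (\<mu> (omit (Suc k) (map fst xs) @ [v])))"
      unfolding sum.distrib[symmetric] by (intro sum.cong) (use lin in \<open>simp_all add: scale_right_distrib\<close>)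
    show "(\<Sum>k<n. scale ((- 1) ^ k * fst (snd (xs ! k))) (\<mu> (omit (Suc k) (map fst xs) @ [scale c v]))) =
        scale c (\<Sum>k<n. scale ((- 1) ^ k * fst (snd (xs ! k))) (\<mu> (omit (Suc k) (map fst xs) @ [v])))"
      unfolding scale_sum_right
      by (intro sum.cong) (use lin in \<open>simp_all only: scale_left_commute[of _ c] lessThan_iff\<close>)
  qed
qed

lemma ad_coeff_derivation:
  assumes "length ys = n"
  shows "ad_coeff xs (\<mu> ys) = (\<Sum>s<n. \<mu> (ys[s := ad_coeff xs (ys ! s)]))"
proof -
  let ?c = "\<lambda>k. (- 1) ^ k * fst (snd (xs ! k))"
  have "ad_coeff xs (\<mu> ys) =
      (\<Sum>k<n. \<Sum>s<n. scale (?c k) (\<mu> (ys[s := \<mu> (omit (Suc k) (map fst xs) @ [ys ! s])])))"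
    unfolding ad_coeff_def
    by (intro sum.cong) (simp_all add: derivation_ad[OF length_omit_fst assms] scale_sum_right)
  also have "\<dots> = (\<Sum>s<n. \<Sum>k<n. \<mu> (ys[s := scale (?c k) (\<mu> (omit (Suc k) (map fst xs) @ [ys ! s]))]))"
    by (subst sum.swap) (intro sum.cong refl; simp add: bracket.scale_entry assms)
  also have "\<dots> = (\<Sum>s<n. \<mu> (ys[s := ad_coeff xs (ys ! s)]))"
    unfolding ad_coeff_def by (intro sum.cong refl bracket.sum_entry[symmetric]) (simp_all add: assms)
  finally show ?thesis .
qed

lemma ad_coeff_skew: "B (ad_coeff xs y) z + B y (ad_coeff xs z) = 0"
proof -
  have "B (ad_coeff xs y) z + B y (ad_coeff xs z) = (\<Sum>k<n. (- 1) ^ k * fst (snd (xs ! k)) *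
      (B (\<mu> (omit (Suc k) (map fst xs) @ [y])) z + B y (\<mu> (omit (Suc k) (map fst xs) @ [z]))))"
    unfolding ad_coeff_def form_sum form_scale sum.distrib[symmetric] distrib_left ..
  also have "\<dots> = 0"
    by (intro sum.neutral) (simp add: form_invariant[OF length_omit_fst])
  finally show ?thesis .
qed

text \<open>
  The first \<open>n\<close> terms add up to \<open>B(A \<mu>(v\<^sub>1,\<dots>,v\<^sub>n), v\<^sub>n\<^sub>+\<^sub>1)\<close> because \<open>A\<close> is a derivation, and the last one
  cancels this because \<open>A\<close> is skew.
\<close>

lemma form3_ad_coeff_invariant:
  assumes "length vs = Suc n"
  shows "(\<Sum>s\<le>n. form3 (vs[s := ad_coeff xs (vs ! s)])) = 0"
proof -
  have "(\<Sum>s\<le>n. form3 (vs[s := ad_coeff xs (vs ! s)])) =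
      (\<Sum>s<n. form3 (vs[s := ad_coeff xs (vs ! s)])) + form3 (vs[n := ad_coeff xs (vs ! n)])"
    by (simp add: lessThan_Suc_atMost[symmetric])
  also have "form3 (vs[n := ad_coeff xs (vs ! n)]) = B (\<mu> (take n vs)) (ad_coeff xs (vs ! n))"
    using assms by simp
  also have "(\<Sum>s<n. form3 (vs[s := ad_coeff xs (vs ! s)])) = B (ad_coeff xs (\<mu> (take n vs))) (vs ! n)"
    using assms
    by (subst ad_coeff_derivation) (simp_all add: form_sum take_update_swap)
  finally show ?thesis using ad_coeff_skew by simp
qed

end

text \<open>
  The adjoint action of \<open>xs\<close> is \<open>(v, a, b) \<mapsto> (A v + a u, 0, B(M, v))\<close> with \<open>M\<close> the bracket of the
  \<open>L\<close>-components of \<open>xs\<close> and \<open>u = \<plusminus>M\<close>, and the claim is that it is a derivation. In the \<open>L\<close>-component,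
  the terms with \<open>A\<close> are accounted for by \<open>A\<close> being a derivation of \<open>\<mu>\<close>; the terms with \<open>u\<close> carry two
  \<open>x\<^sub>0\<close>-coefficients and cancel in pairs. In the \<open>x\<^sub>-\<^sub>1\<close>-component, the terms with \<open>A\<close> vanish by
  invariance, and the terms with \<open>u\<close> are the left-hand side because \<open>B\<close> is symmetric.
\<close>

lemma ext_fundamental_identity:
  assumes lx: "length xs = n" and ly: "length ys = Suc n"
  shows "ext_mu (xs @ [ext_mu ys]) = (\<Sum>s<Suc n. ext_mu (ys[s := ext_mu (xs @ [ys ! s])]))"
proof -
  let ?A = "ad_coeff xs" and ?M = "\<mu> (map fst xs)" and ?vs = "map fst ys"
  let ?u = "scale ((- 1) ^ n) ?M"
  define a where "a k = fst (snd (ys ! k))" for k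
  interpret A: Vector_Spaces.linear scale scale ?A by (rule linear_ad_coeff[OF lx])
  have lvs: "length ?vs = Suc n" using ly by simp
  have upd: "ext_mu (ys[s := ext_mu (xs @ [ys ! s])]) =
      ((\<Sum>k\<in>{..n} - {s}. scale ((- 1) ^ k * a k) (\<mu> (omit (Suc k) (?vs[s := ?A (?vs ! s)])))) +
       (\<Sum>k\<in>{..n} - {s}. scale ((- 1) ^ k * a k * a s) (\<mu> (omit (Suc k) (?vs[s := ?u])))),
       0,
       form3 (?vs[s := ?A (?vs ! s)]) + a s * form3 (?vs[s := ?u]))" if s: "s \<le> n" for s
  proof -
    let ?w = "ext_mu (xs @ [ys ! s])"
    have w: "?w = (?A (?vs ! s) + scale (a s) ?u, 0, B ?M (?vs ! s))"
      using s ly by (simp add: ext_mu_snoc[OF lx] a_def)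
    have v': "map fst (ys[s := ?w]) = ?vs[s := ?A (?vs ! s) + scale (a s) ?u]"
      unfolding w by (simp add: map_update)
    have split: "\<mu> (omit (Suc k) (?vs[s := ?A (?vs ! s) + scale (a s) ?u])) =
        \<mu> (omit (Suc k) (?vs[s := ?A (?vs ! s)])) + scale (a s) (\<mu> (omit (Suc k) (?vs[s := ?u])))"
      if k: "k \<le> n" "k \<noteq> s" for k
    proof -
      have "k < length ?vs" "s < length ?vs" "s \<noteq> k" "shift k s < n"
          "length (omit (Suc k) ?vs) = n"
        using k s ly by (auto simp: shift_less length_omit)
      then show ?thesis
        by (simp only: omit_update_other bracket.add_entry bracket.scale_entry simp_thms)
    qed
    have "(\<Sum>k\<le>n. scale ((- 1) ^ k * fst (snd (ys[s := ?w] ! k))) (\<mu> (omit (Suc k) (map fst (ys[s := ?w]))))) =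
        (\<Sum>k\<in>{..n} - {s}. scale ((- 1) ^ k * fst (snd (ys[s := ?w] ! k))) (\<mu> (omit (Suc k) (map fst (ys[s := ?w])))))"
      using s ly w by (intro sum.mono_neutral_right) auto
    also have "\<dots> = (\<Sum>k\<in>{..n} - {s}. scale ((- 1) ^ k * a k) (\<mu> (omit (Suc k) (?vs[s := ?A (?vs ! s)])))
        + scale ((- 1) ^ k * a k * a s) (\<mu> (omit (Suc k) (?vs[s := ?u]))))"
      unfolding v'
    proof (rule sum.cong)
      fix k assume "k \<in> {..n} - {s}"
      then have k: "k \<le> n" "k \<noteq> s" by auto
      then have "fst (snd (ys[s := ?w] ! k)) = a k" by (simp add: a_def)
      then show "scale ((- 1) ^ k * fst (snd (ys[s := ?w] ! k)))
            (\<mu> (omit (Suc k) (?vs[s := ?A (?vs ! s) + scale (a s) ?u]))) =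
          scale ((- 1) ^ k * a k) (\<mu> (omit (Suc k) (?vs[s := ?A (?vs ! s)]))) +
          scale ((- 1) ^ k * a k * a s) (\<mu> (omit (Suc k) (?vs[s := ?u])))"
        unfolding split[OF k] by (simp add: scale_right_distrib)
    qed simp
    finally have 1: "(\<Sum>k\<le>n. scale ((- 1) ^ k * fst (snd (ys[s := ?w] ! k))) (\<mu> (omit (Suc k) (map fst (ys[s := ?w]))))) =
       (\<Sum>k\<in>{..n} - {s}. scale ((- 1) ^ k * a k) (\<mu> (omit (Suc k) (?vs[s := ?A (?vs ! s)])))) +
       (\<Sum>k\<in>{..n} - {s}. scale ((- 1) ^ k * a k * a s) (\<mu> (omit (Suc k) (?vs[s := ?u]))))"
      unfolding sum.distrib .
    have 2: "form3 (map fst (ys[s := ?w])) = form3 (?vs[s := ?A (?vs ! s)]) + a s * form3 (?vs[s := ?u])"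
      unfolding v' using form3.add_entry[OF lvs, of s] form3.scale_entry[OF lvs, of s] s
      by simp
    show ?thesis
      using ext_mu_eq[of "ys[s := ?w]"] ly unfolding 1 2 by simp
  qed
  have main: "(\<Sum>s\<le>n. \<Sum>k\<in>{..n} - {s}. scale ((- 1) ^ k * a k) (\<mu> (omit (Suc k) (?vs[s := ?A (?vs ! s)])))) =
      ?A (\<Sum>k\<le>n. scale ((- 1) ^ k * a k) (\<mu> (omit (Suc k) ?vs)))"
  proof -
    have inner: "(\<Sum>s\<in>{..n} - {k}. \<mu> (omit (Suc k) (?vs[s := ?A (?vs ! s)]))) = ?A (\<mu> (omit (Suc k) ?vs))"
      if k: "k \<le> n" for k
    proof -
      have l: "length (omit (Suc k) ?vs) = n" using k ly by (simp add: length_omit)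
      have "?A (\<mu> (omit (Suc k) ?vs)) = (\<Sum>s<n. \<mu> ((omit (Suc k) ?vs)[s := ?A (omit (Suc k) ?vs ! s)]))"
        by (rule ad_coeff_derivation[OF lx l])
      also have "\<dots> = (\<Sum>s\<in>{..n} - {k}. \<mu> (omit (Suc k) (?vs[s := ?A (?vs ! s)])))"
        unfolding sum_shift[OF k]
        by (intro sum.cong refl) (use lvs k in \<open>simp only: nth_omit_shift omit_update_other Diff_iff atMost_iff less_Suc_eq_le insert_iff empty_iff simp_thms\<close>)
      finally show ?thesis ..
    qed
    have "(\<Sum>s\<le>n. \<Sum>k\<in>{..n} - {s}. scale ((- 1) ^ k * a k) (\<mu> (omit (Suc k) (?vs[s := ?A (?vs ! s)])))) =
        (\<Sum>k\<le>n. \<Sum>s\<in>{..n} - {k}. scale ((- 1) ^ k * a k) (\<mu> (omit (Suc k) (?vs[s := ?A (?vs ! s)]))))"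
      by (rule sum_off_diagonal_swap)
    also have "\<dots> = (\<Sum>k\<le>n. scale ((- 1) ^ k * a k) (?A (\<mu> (omit (Suc k) ?vs))))"
      unfolding scale_sum_right[symmetric] by (intro sum.cong refl) (simp add: inner)
    also have "\<dots> = ?A (\<Sum>k\<le>n. scale ((- 1) ^ k * a k) (\<mu> (omit (Suc k) ?vs)))"
      by (simp add: A.sum A.scale)
    finally show ?thesis .
  qed
  have form: "a s * form3 (?vs[s := ?u]) = (- 1) ^ s * a s * B ?M (\<mu> (omit (Suc s) ?vs))" if s: "s \<le> n" for s
  proof -
    have "length (omit (Suc s) ?vs) = n" using s ly by (simp add: length_omit)
    then have "form3 (?vs[s := ?u]) = (- 1) ^ (n - s) * ((- 1) ^ n * B (\<mu> (omit (Suc s) ?vs)) ?M)"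
      using form3.update_eq_snoc[OF lvs, of s ?u] s by (simp add: nth_append form_scale)
    also have "(- 1 :: 'a) ^ (n - s) * ((- 1) ^ n * b) = (- 1) ^ s * b" for b
    proof -
      have "(- 1 :: 'a) ^ (n - s) * (- 1) ^ n = (- 1) ^ (s + 2 * (n - s))"
        unfolding power_add[symmetric]
        by (rule arg_cong[where f = "\<lambda>e. (- 1) ^ e"]) (use s in simp)
      also have "\<dots> = (- 1) ^ s" by (simp add: power_add power_mult)
      finally show ?thesis by (simp only: mult.assoc[symmetric])
    qed
    finally have "form3 (?vs[s := ?u]) = (- 1) ^ s * B ?M (\<mu> (omit (Suc s) ?vs))"
      unfolding form_symmetric[of ?M] .
    then show ?thesis by simp
  qed
  have "ext_mu (xs @ [ext_mu ys]) =
      (?A (\<Sum>k\<le>n. scale ((- 1) ^ k * a k) (\<mu> (omit (Suc k) ?vs))), 0,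
       \<Sum>k\<le>n. (- 1) ^ k * a k * B ?M (\<mu> (omit (Suc k) ?vs)))"
    by (simp add: ext_mu_snoc[OF lx] ext_mu_eq[OF ly] form_sum form_scale a_def)
  also have "\<dots> = (\<Sum>s\<le>n. ext_mu (ys[s := ext_mu (xs @ [ys ! s])]))"
  proof -
    have "(\<Sum>s\<le>n. ext_mu (ys[s := ext_mu (xs @ [ys ! s])])) = (\<Sum>s\<le>n.
      ((\<Sum>k\<in>{..n} - {s}. scale ((- 1) ^ k * a k) (\<mu> (omit (Suc k) (?vs[s := ?A (?vs ! s)])))) +
       (\<Sum>k\<in>{..n} - {s}. scale ((- 1) ^ k * a k * a s) (\<mu> (omit (Suc k) (?vs[s := ?u])))),
       0,
       form3 (?vs[s := ?A (?vs ! s)]) + (- 1) ^ s * a s * B ?M (\<mu> (omit (Suc s) ?vs))))"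
      by (intro sum.cong refl) (simp add: upd form)
    also have "\<dots> = ((\<Sum>s\<le>n. \<Sum>k\<in>{..n} - {s}. scale ((- 1) ^ k * a k) (\<mu> (omit (Suc k) (?vs[s := ?A (?vs ! s)])))) +
       (\<Sum>s\<le>n. \<Sum>k\<in>{..n} - {s}. scale ((- 1) ^ k * a k * a s) (\<mu> (omit (Suc k) (?vs[s := ?u])))),
       0,
       (\<Sum>s\<le>n. form3 (?vs[s := ?A (?vs ! s)])) + (\<Sum>s\<le>n. (- 1) ^ s * a s * B ?M (\<mu> (omit (Suc s) ?vs))))"
      by (simp only: sum_prod_triple sum.distrib sum.neutral_const)
    finally show ?thesis
      unfolding main bracket.sum_omit_update_cancel[OF lvs] form3_ad_coeff_invariant[OF lx lvs] by simp
  qed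
  finally show ?thesis by (simp add: lessThan_Suc_atMost)
qed

sublocale ext_n_lie: n_lie_algebra "ext_scale scale" "n + 1" ext_mu
proof
  show "alternating_multilinear (ext_scale scale) (ext_scale scale) (n + 1) ext_mu"
    using ext_bracket.alternating_map_axioms unfolding alternating_map_iff by simp
  fix xs ys :: "('v \<times> 'a \<times> 'a) list"
  assume l: "length xs = n + 1 - 1" "length ys = n + 1"
  then show "ext_mu (xs @ [ext_mu ys]) = (\<Sum>s = 1..n + 1. ext_scale scale ((- 1) ^ (n + 1 - s))
      (ext_mu (omit s ys @ [ext_mu (xs @ [ys ! (s - 1)])])))"
    using ext_bracket.sum_snoc_eq_sum_update[of ys "\<lambda>y. ext_mu (xs @ [y])"]
      ext_fundamental_identity[of xs ys] by simp
qed

text \<open>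
  The next three lemmas compute the bracket on the tuples by which it is specified. They are also used
  for the dual space, where \<open>x\<^sup>-\<^sup>1\<close> plays the part of \<open>x\<^sub>0\<close> and \<open>x\<^sup>0\<close> that of \<open>x\<^sub>-\<^sub>1\<close>.
\<close>

lemma ext_mu_zero:
  assumes len: "length ws = Suc n" and "(0, 0, c) \<in> set ws"
  shows "ext_mu ws = 0"
proof -
  obtain i where i: "i \<le> n" "ws ! i = (0, 0, c)" using assms by (auto simp: in_set_conv_nth less_Suc_eq_le)
  let ?vs = "map fst ws"
  have vi: "?vs ! i = 0" using i len by simp
  have "scale ((- 1) ^ k * fst (snd (ws ! k))) (\<mu> (omit (Suc k) ?vs)) = 0" if k: "k \<le> n" for k
  proof (cases "k = i")
    case False
    then have "omit (Suc k) ?vs ! shift k i = 0" "shift k i < n"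
      using i k len vi nth_omit_shift[of k ?vs i] by (auto simp: shift_less)
    then have "0 \<in> set (omit (Suc k) ?vs)"
      using k len by (metis length_omit length_map diff_Suc_1 less_Suc_eq_le nth_mem)
    then have "\<mu> (omit (Suc k) ?vs) = 0"
      using k len by (intro bracket.zero_in_set) (auto simp: length_omit)
    then show ?thesis by simp
  qed (use i in simp)
  then have "(\<Sum>k\<le>n. scale ((- 1) ^ k * fst (snd (ws ! k))) (\<mu> (omit (Suc k) ?vs))) = 0"
    by (intro sum.neutral) simp
  moreover have "form3 ?vs = 0"
    using i len vi nth_mem[of i ?vs] by (intro form3.zero_in_set) simp_all
  ultimately show ?thesis by (simp add: ext_mu_eq[OF len] zero_prod_def)
qed

lemma ext_mu_put_at:
  assumes len: "length vs = n" and k: "k \<le> n"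
  shows "ext_mu (put_at (Suc k) (0, 1, 0) (map embed vs)) = ext_scale scale ((- 1) ^ k) (embed (\<mu> vs))"
proof -
  let ?ws = "put_at (Suc k) (0, 1, 0) (map embed vs) :: ('v \<times> 'a \<times> 'a) list"
  have lw: "length ?ws = Suc n" by (simp add: length_put_at len)
  have fst: "map fst ?ws = put_at (Suc k) 0 vs" by (simp add: map_put_at o_def embed_def)
  have wk: "?ws ! k = (0, 1, 0)" using len k by (simp add: nth_put_at)
  have other: "fst (snd (?ws ! j)) = 0" if j: "j \<le> n" "j \<noteq> k" for j
  proof -
    have "?ws ! j = omit (Suc k) ?ws ! shift k j"
      using nth_omit_shift[of k ?ws j] j k lw by simp
    also have "\<dots> = map embed vs ! shift k j" using len k by (simp add: omit_put_at)
    also have "\<dots> = embed (vs ! shift k j)" using len k j by (simp add: shift_less)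
    finally show ?thesis by (simp add: embed_def)
  qed
  have "(\<Sum>j\<le>n. scale ((- 1) ^ j * fst (snd (?ws ! j))) (\<mu> (omit (Suc j) (map fst ?ws)))) =
      (\<Sum>j\<in>{k}. scale ((- 1) ^ j * fst (snd (?ws ! j))) (\<mu> (omit (Suc j) (map fst ?ws))))"
    using k other by (intro sum.mono_neutral_right) auto
  also have "\<dots> = scale ((- 1) ^ k) (\<mu> vs)"
    unfolding fst using len k by (simp add: wk omit_put_at)
  finally have 1: "(\<Sum>j\<le>n. scale ((- 1) ^ j * fst (snd (?ws ! j))) (\<mu> (omit (Suc j) (map fst ?ws)))) =
      scale ((- 1) ^ k) (\<mu> vs)" .
  have 2: "form3 (map fst ?ws) = 0"
    unfolding fst using len by (intro form3.zero_in_set) (auto simp: length_put_at set_put_at)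
  show ?thesis
    unfolding ext_mu_eq[OF lw] 1 2 by (simp add: ext_scale_def embed_def)
qed

lemma ext_mu_embed:
  assumes "length vs = Suc n"
  shows "ext_mu (map embed vs) = (0, 0, B (\<mu> (take n vs)) (vs ! n))"
  using assms by (simp add: ext_mu_eq o_def embed_def)

end

section \<open>Functionals and tensors\<close>

definition dual_scale :: "'a::field \<Rightarrow> ('v \<Rightarrow> 'a) \<Rightarrow> 'v \<Rightarrow> 'a" where
  "dual_scale c f = (\<lambda>v. c * f v)"

lemma vector_space_dual_scale: "vector_space (dual_scale :: 'a::field \<Rightarrow> ('v \<Rightarrow> 'a) \<Rightarrow> _)"
  by unfold_locales (auto simp: dual_scale_def algebra_simps fun_eq_iff)

lemma sum_fun_apply: "(\<Sum>j\<in>J. F j) v = (\<Sum>j\<in>J. F j v)"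
  by (induction J rule: infinite_finite_induct) auto

lemma multilinear_map_evaluation:
  "multilinear_map dual_scale (*) n (\<lambda>fs. \<Prod>i<n. (fs ! i) (vs ! i) :: 'a::field_char_0)"
  unfolding multilinear_map_def
proof (intro allI impI)
  fix fs :: "('b \<Rightarrow> 'a) list" and i
  assume len: "length fs = n" and i: "i < n"
  have "(\<Prod>j<n. (fs[i := f] ! j) (vs ! j)) = f (vs ! i) * (\<Prod>j\<in>{..<n} - {i}. (fs ! j) (vs ! j))" for f
  proof -
    have "(\<Prod>j<n. (fs[i := f] ! j) (vs ! j)) =
        (fs[i := f] ! i) (vs ! i) * (\<Prod>j\<in>{..<n} - {i}. (fs[i := f] ! j) (vs ! j))"
      using i by (intro prod.remove) auto
    then show ?thesis using len i by simp
  qed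
  then show "Vector_Spaces.linear dual_scale (*) (\<lambda>f. \<Prod>j<n. (fs[i := f] ! j) (vs ! j))"
    by (simp add: Vector_Spaces.linear_iff vector_space_dual_scale vector_space_field
        dual_scale_def distrib_right)
qed

lemma multilinear_map_add:
  assumes "multilinear_map scaleV (*) n f" "multilinear_map scaleV (*) n g"
  shows "multilinear_map scaleV (*) n (\<lambda>vs. c * f vs + g vs)"
  using assms unfolding multilinear_map_def Vector_Spaces.linear_iff
  by (simp add: distrib_left mult.left_commute[of c])

lemma multilinear_map_zero:
  "vector_space scaleV \<Longrightarrow> multilinear_map scaleV ((*) :: 'a::field \<Rightarrow> _) n (\<lambda>vs. 0)"
  unfolding multilinear_map_def Vector_Spaces.linear_iff
  by (simp add: vector_space_field)

text \<open>
  A pure tensor is the evaluation at a tuple of vectors, which makes sense for tuples of arbitrary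
  functions. In contrast to the tensor itself, which is cut off outside \<open>L\<^sup>*\<close>, the resulting extension
  is multilinear on a whole type.
\<close>

lemma tensor_power_multilinear_extension:
  fixes scale :: "'a::field_char_0 \<Rightarrow> 'v::ab_group_add \<Rightarrow> 'v"
  assumes "t \<in> tensor_power scale n"
  shows "\<exists>f. multilinear_map dual_scale (*) n f \<and> t = on_dual scale n f"
proof -
  interpret T: vector_space "tensor_scale :: 'a \<Rightarrow> ('a, 'v) tensor \<Rightarrow> _"
    by (rule vector_space_tensor_scale)
  show ?thesis
    using assms unfolding tensor_power_def
  proof (induction rule: T.span_induct_alt)
    case base
    have "on_dual scale n (\<lambda>fs. 0) = 0" by (auto simp: on_dual_def)
    then show ?case using multilinear_map_zero[OF vector_space_dual_scale, of n] by force
  next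
    case (step c u t)
    then obtain vs f where vs: "length vs = n" "u = pure_tensor scale vs"
      and f: "multilinear_map dual_scale (*) n f" "t = on_dual scale n f" by auto
    have "tensor_scale c u + t =
        on_dual scale n (\<lambda>fs. c * (\<Prod>i<n. (fs ! i) (vs ! i)) + f fs)"
      using vs f by (auto simp: pure_tensor_def on_dual_def tensor_scale_def)
    then show ?case
      using multilinear_map_add[OF multilinear_map_evaluation f(1), of c vs] by blast
  qed
qed

text \<open>
  Induction on \<open>k\<close>, the number of initial entries that range over the span and not only over \<open>S\<close>.
\<close>

lemma multilinear_eq_on_span:
  assumes "multilinear scaleV scaleW n f" "multilinear scaleV scaleW n g"
    and eq: "\<And>vs. length vs = n \<Longrightarrow> set vs \<subseteq> S \<Longrightarrow> f vs = g vs"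
    and "length vs = n" "set vs \<subseteq> module.span scaleV S"
  shows "f vs = g vs"
proof -
  interpret f: multilinear scaleV scaleW n f by fact
  interpret g: multilinear scaleV scaleW n g by fact
  interpret vector_space_pair scaleV scaleW by unfold_locales
  have "f vs = g vs"
    if "k \<le> n" "length vs = n" "set vs \<subseteq> f.V.span S" "set (drop k vs) \<subseteq> S" for k vs
    using that
  proof (induction k arbitrary: vs)
    case 0
    then show ?case using eq by simp
  next
    case (Suc k)
    have k: "k < n" using Suc.prems by simp
    have "f (vs[k := v]) = g (vs[k := v])" if v: "v \<in> S" for v
    proof (rule Suc.IH)
      show "set (vs[k := v]) \<subseteq> f.V.span S"
        using Suc.prems(3) v set_update_subset_insert[of vs k v] by (auto intro: f.V.span_base)
      have "drop k (vs[k := v]) = v # drop (Suc k) vs"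
        using k Suc.prems(2) by (metis Cons_nth_drop_Suc drop_update_cancel length_list_update
            lessI nth_list_update_eq)
      then show "set (drop k (vs[k := v])) \<subseteq> S" using v Suc.prems(4) by simp
    qed (use Suc.prems in auto)
    moreover have "vs ! k \<in> f.V.span S" using Suc.prems k by (auto intro: subsetD)
    ultimately have "f (vs[k := vs ! k]) = g (vs[k := vs ! k])"
      using Suc.prems(2) k
      using linear_eq_on[OF f.linear_entry[of vs k] g.linear_entry[of vs k], of "vs ! k" S] by simp
    then show ?case by simp
  qed
  from this[of n vs] show ?thesis using assms by simp
qed

lemma dual_space_linear: "f \<in> dual_space scale \<longleftrightarrow> Vector_Spaces.linear scale (*) f"
  by (simp add: dual_space_def)

section \<open>Finite bases\<close>

locale finite_basis = vector_space scale
  for scale :: "'a::field_char_0 \<Rightarrow> 'v::ab_group_add \<Rightarrow> 'v" +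
  fixes I :: "'i set" and e :: "'i \<Rightarrow> 'v"
  assumes finite_index: "finite I"
    and basis: "basis_family scale I e"
begin

abbreviation dual :: "'i \<Rightarrow> 'v \<Rightarrow> 'a" where
  "dual \<equiv> dual_basis scale I e"

lemma dual_in_dual_space: "dual i \<in> dual_space scale"
  using linear_representation basis by (auto simp: dual_space_def dual_basis_def basis_family_def)

lemma dual_apply: "i \<in> I \<Longrightarrow> j \<in> I \<Longrightarrow> dual i (e j) = (if i = j then 1 else 0)"
  using dual_basis_apply[OF vector_space_axioms basis] .

lemma expand: "v = (\<Sum>i\<in>I. scale (dual i v) (e i))"
proof -
  have "inj_on e I" "independent (e ` I)" "span (e ` I) = UNIV"
    using basis by (auto simp: basis_family_def)
  then have "v = (\<Sum>b\<in>e ` I. scale (representation (e ` I) v b) b)"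
    using finite_index by (intro sum_representation_eq[symmetric]) auto
  also have "\<dots> = (\<Sum>i\<in>I. scale (dual i v) (e i))"
    using \<open>inj_on e I\<close> by (simp add: sum.reindex dual_basis_def)
  finally show ?thesis .
qed

lemma functional_expand:
  assumes "f \<in> dual_space scale"
  shows "f v = (\<Sum>i\<in>I. f (e i) * dual i v)"
proof -
  interpret f: Vector_Spaces.linear scale "(*)" f using assms by (simp add: dual_space_def)
  have "f v = f (\<Sum>i\<in>I. scale (dual i v) (e i))" using expand by simp
  also have "\<dots> = (\<Sum>i\<in>I. f (e i) * dual i v)" by (simp add: f.sum f.scale mult.commute)
  finally show ?thesis .
qed

lemma dual_eqI:
  assumes "f \<in> dual_space scale" "i \<in> I" "\<And>j. j \<in> I \<Longrightarrow> f (e j) = (if i = j then 1 else 0)"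
  shows "dual i = f"
proof
  fix v
  have "f v = (\<Sum>j\<in>I. f (e j) * dual j v)" by (rule functional_expand[OF assms(1)])
  also have "\<dots> = (\<Sum>j\<in>I. if i = j then dual i v else 0)"
    by (intro sum.cong) (auto simp: assms(3))
  also have "\<dots> = dual i v" using assms(2) finite_index by simp
  finally show "dual i v = f v" ..
qed

text \<open>
  The linear functional with the same values as \<open>f\<close> on the basis. It is a linear retraction of the
  space of all functions onto \<open>L\<^sup>*\<close>, and turns structures on \<open>L\<^sup>*\<close> into structures on a type.
\<close>

definition linearize :: "('v \<Rightarrow> 'a) \<Rightarrow> 'v \<Rightarrow> 'a" where
  "linearize f = (\<lambda>v. \<Sum>i\<in>I. f (e i) * dual i v)"

lemma linearize_in_dual_space: "linearize f \<in> dual_space scale"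
proof -
  have "Vector_Spaces.linear scale (*) (dual i)" for i
    using dual_in_dual_space by (simp add: dual_space_def)
  then show ?thesis
    unfolding dual_space_def linearize_def Vector_Spaces.linear_iff mem_Collect_eq
    by (simp add: distrib_left sum.distrib sum_distrib_left mult_ac)
qed

lemma linearize_id: "f \<in> dual_space scale \<Longrightarrow> linearize f = f"
  using functional_expand by (auto simp: linearize_def)

lemma map_linearize_id: "set fs \<subseteq> dual_space scale \<Longrightarrow> map linearize fs = fs"
  by (simp add: linearize_id map_idI subset_iff)

lemma set_linearize: "set (map linearize fs) \<subseteq> dual_space scale"
  using linearize_in_dual_space by auto

lemma linear_linearize: "Vector_Spaces.linear dual_scale dual_scale linearize"
  unfolding Vector_Spaces.linear_iff
proof (intro conjI allI vector_space_dual_scale)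
  fix f g :: "'v \<Rightarrow> 'a" and c
  show "linearize (f + g) = linearize f + linearize g"
    unfolding linearize_def fun_eq_iff plus_fun_apply distrib_right sum.distrib by simp
  show "linearize (dual_scale c f) = dual_scale c (linearize f)"
    unfolding linearize_def dual_scale_def fun_eq_iff sum_distrib_left mult.assoc by simp
qed

lemma multilinear_linearize:
  assumes "t \<in> tensor_power scale n"
  shows "multilinear dual_scale (*) n (\<lambda>fs. t (map linearize fs))"
proof -
  obtain f where f: "multilinear_map dual_scale (*) n f" and t: "t = on_dual scale n f"
    using tensor_power_multilinear_extension[OF assms] by auto
  have "multilinear_map dual_scale (*) n (\<lambda>fs. t (map linearize fs))"
    unfolding multilinear_map_def
  proof (intro allI impI)
    fix fs :: "('v \<Rightarrow> 'a) list" and i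
    assume len: "length fs = n" and i: "i < n"
    have "Vector_Spaces.linear dual_scale (*) (\<lambda>g. f ((map linearize fs)[i := g]))"
      using f len i by (simp add: multilinear_map_def)
    from Vector_Spaces.linear_compose[OF linear_linearize this]
    show "Vector_Spaces.linear dual_scale (*) (\<lambda>g. t (map linearize (fs[i := g])))"
      using len set_linearize by (simp add: o_def t on_dual_def map_update[symmetric] del: set_map)
  qed
  then show ?thesis
    by (simp add: multilinear_def multilinear_axioms_def vector_space_dual_scale vector_space_field)
qed

lemma alternating_linearize:
  assumes "t \<in> wedge_power scale n"
  shows "alternating_map dual_scale (*) n (\<lambda>fs. t (map linearize fs))"
proof -
  have t: "t \<in> tensor_power scale n"
    and perm: "\<And>\<sigma> fs. \<sigma> permutes {..<n} \<Longrightarrow> length fs = n \<Longrightarrow>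
      t (permute_list \<sigma> fs) = of_int (sign \<sigma>) * t fs"
    using assms by (auto simp: wedge_power_def)
  interpret multilinear dual_scale "(*)" n "\<lambda>fs. t (map linearize fs)"
    by (rule multilinear_linearize[OF t])
  show ?thesis
  proof
    fix \<sigma> and fs :: "('v \<Rightarrow> 'a) list"
    assume *: "\<sigma> permutes {..<n}" "length fs = n"
    have "(of_int (sign \<sigma>) :: 'a) * of_int (sign \<sigma>) = 1"
      by (simp flip: of_int_mult)
    then show "t (map linearize fs) = of_int (sign \<sigma>) * t (map linearize (permute_list \<sigma> fs))"
      using * perm[of \<sigma> "map linearize fs"] by (simp add: permute_list_map flip: mult.assoc)
  qed
qed

lemma dual_space_span: "dual_space scale \<subseteq> module.span dual_scale (dual ` I)"
proof
  interpret D: vector_space "dual_scale :: 'a \<Rightarrow> ('v \<Rightarrow> 'a) \<Rightarrow> _" by (rule vector_space_dual_scale)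
  fix f assume "f \<in> dual_space scale"
  then have "f = (\<Sum>i\<in>I. dual_scale (f (e i)) (dual i))"
    by (auto simp: sum_fun_apply dual_scale_def functional_expand)
  also have "\<dots> \<in> D.span (dual ` I)"
    by (intro D.span_sum D.span_scale D.span_base) auto
  finally show "f \<in> D.span (dual ` I)" .
qed

lemma multilinear_dual_eqI:
  assumes "multilinear dual_scale (*) n f" "multilinear dual_scale (*) n g"
    and eq: "\<And>is. length is = n \<Longrightarrow> set is \<subseteq> I \<Longrightarrow> f (map dual is) = g (map dual is)"
    and fs: "length fs = n" "set fs \<subseteq> dual_space scale"
  shows "f fs = g fs"
proof (rule multilinear_eq_on_span[OF assms(1,2), where S = "dual ` I"])
  fix hs assume "length hs = n" and hs: "set hs \<subseteq> dual ` I"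
  moreover have "hs \<in> map dual ` lists I"
    using hs unfolding lists_image[symmetric] by (simp add: lists_eq_set)
  then obtain "is" where "hs = map dual is" "set is \<subseteq> I" by auto
  ultimately show "f hs = g hs" using eq by simp
qed (use fs dual_space_span in auto)

text \<open>
  The tensor is \<open>\<Sum> f(e\<^sup>i\<^sup>1,\<dots>,e\<^sup>i\<^sup>n) e\<^sub>i\<^sub>1 \<otimes> \<dots> \<otimes> e\<^sub>i\<^sub>n\<close>, summed over all index tuples: both sides are
  multilinear and agree on tuples of dual basis vectors.
\<close>

lemma tensor_powerI:
  assumes "multilinear_map dual_scale (*) n f"
  shows "on_dual scale n f \<in> tensor_power scale n"
proof -
  interpret T: vector_space "tensor_scale :: 'a \<Rightarrow> ('a, 'v) tensor \<Rightarrow> _"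
    by (rule vector_space_tensor_scale)
  let ?N = "{is. set is \<subseteq> I \<and> length is = n}"
  define g where "g fs = (\<Sum>is\<in>?N. f (map dual is) * (\<Prod>i<n. (fs ! i) (map e is ! i)))" for fs
  have fin: "finite ?N" by (rule finite_lists_length_eq[OF finite_index])
  have "multilinear_map dual_scale (*) n (\<lambda>fs. \<Sum>is\<in>N. f (map dual is) * (\<Prod>i<n. (fs ! i) (map e is ! i)))"
    if "finite N" for N
    using that
  proof (induction N)
    case empty
    then show ?case using multilinear_map_zero[OF vector_space_dual_scale] by simp
  next
    case (insert js N)
    then show ?case
      using multilinear_map_add[OF multilinear_map_evaluation insert.IH, of "f (map dual js)" "map e js"]
      by simp
  qed
  then have g: "multilinear_map dual_scale (*) n g" unfolding g_def using fin by blast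
  have eq: "f (map dual js) = g (map dual js)" if js: "length js = n" "set js \<subseteq> I" for js
  proof -
    have "(\<Prod>i<n. (map dual js ! i) (map e is ! i)) = (if js = is then 1 else 0)" if "is": "is \<in> ?N" for "is"
    proof (cases "js = is")
      case True
      have "(\<Prod>i<n. (map dual js ! i) (map e is ! i)) = (\<Prod>i<n. 1)"
        using js True by (intro prod.cong) (auto simp: dual_apply subset_iff)
      then show ?thesis using True by simp
    next
      case False
      then obtain i where "i < n" "js ! i \<noteq> is ! i"
        using js "is" by (metis (mono_tags, lifting) mem_Collect_eq nth_equalityI)
      then have "(map dual js ! i) (map e is ! i) = 0"
        using js "is" by (auto simp: dual_apply subset_iff)
      then show ?thesis using \<open>i < n\<close> False by auto
    qed
    then have "g (map dual js) = (\<Sum>is\<in>?N. if js = is then f (map dual is) else 0)"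
      unfolding g_def by (intro sum.cong) auto
    also have "\<dots> = f (map dual js)" using js fin by simp
    finally show ?thesis ..
  qed
  have "f fs = g fs" if "length fs = n" "set fs \<subseteq> dual_space scale" for fs
    using multilinear_dual_eqI[of n f g fs] eq that assms g
    by (simp add: multilinear_def multilinear_axioms_def vector_space_dual_scale vector_space_field)
  then have "on_dual scale n f = on_dual scale n g" by (auto simp: on_dual_def)
  also have "\<dots> = (\<Sum>is\<in>?N. tensor_scale (f (map dual is)) (pure_tensor scale (map e is)))"
  proof
    fix fs
    show "on_dual scale n g fs =
        (\<Sum>is\<in>?N. tensor_scale (f (map dual is)) (pure_tensor scale (map e is))) fs"
    proof (cases "length fs = n \<and> set fs \<subseteq> dual_space scale")
      case True
      then show ?thesis
        unfolding sum_fun_apply g_def by (auto simp: on_dual_def tensor_scale_def pure_tensor_def intro!: sum.cong)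
    next
      case False
      have "tensor_scale (f (map dual is)) (pure_tensor scale (map e is)) fs = 0" if "is \<in> ?N" for "is"
        using False that unfolding tensor_scale_def pure_tensor_def on_dual_def by auto
      with False show ?thesis unfolding sum_fun_apply on_dual_def by auto
    qed
  qed
  also have "\<dots> \<in> tensor_power scale n"
    unfolding tensor_power_def by (intro T.span_sum T.span_scale T.span_base) auto
  finally show ?thesis .
qed

end

section \<open>The dual of an \<open>n\<close>-Lie coalgebra\<close>

lemma dual_map_in_dual_space:
  assumes "Vector_Spaces.linear scale tensor_scale \<Delta>"
  shows "dual_map \<Delta> fs \<in> dual_space scale"
  using assms unfolding dual_space_def dual_map_def Vector_Spaces.linear_iff
  by (auto simp: tensor_scale_def vector_space_field)

text \<open>
  Pairing the coalgebra identity with \<open>x\<^sub>1 \<otimes> \<dots> \<otimes> x\<^sub>n\<^sub>-\<^sub>1 \<otimes> y\<^sub>1 \<otimes> \<dots> \<otimes> y\<^sub>n\<close> yields the fundamental identity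
  for \<open>\<Delta>\<^sup>*\<close>, evaluated at \<open>v\<close>.
\<close>

lemma co_identity_iff:
  fixes scale :: "'a::field \<Rightarrow> 'v::ab_group_add \<Rightarrow> 'v"
  assumes lin: "Vector_Spaces.linear scale tensor_scale \<Delta>" and n: "n > 0"
  shows "id_tensor scale n \<Delta> (\<Delta> v)
         - (\<Sum>s = 1..n. tensor_scale ((- 1) ^ (n - s)) (omega scale n s (id_tensor scale n \<Delta> (\<Delta> v)))) = 0
    \<longleftrightarrow> (\<forall>xs ys. length xs = n - 1 \<longrightarrow> length ys = n \<longrightarrow>
      set xs \<subseteq> dual_space scale \<longrightarrow> set ys \<subseteq> dual_space scale \<longrightarrow>
      \<Delta> v (xs @ [dual_map \<Delta> ys]) =
      (\<Sum>s = 1..n. (- 1) ^ (n - s) * \<Delta> v (omit s ys @ [dual_map \<Delta> (xs @ [ys ! (s - 1)])])))"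
    (is "?T = 0 \<longleftrightarrow> ?R")
proof -
  have id: "id_tensor scale n \<Delta> (\<Delta> v) (xs @ ys) = \<Delta> v (xs @ [dual_map \<Delta> ys])"
    if "length xs = n - 1" "length ys = n" "set xs \<subseteq> dual_space scale" "set ys \<subseteq> dual_space scale"
    for xs ys
  proof -
    have "n - 1 + n = 2 * n - 1" using n by simp
    then show ?thesis using that by (simp add: id_tensor_def on_dual_def dual_map_def)
  qed
  have T: "?T (xs @ ys) = \<Delta> v (xs @ [dual_map \<Delta> ys]) -
      (\<Sum>s = 1..n. (- 1) ^ (n - s) * \<Delta> v (omit s ys @ [dual_map \<Delta> (xs @ [ys ! (s - 1)])]))"
    if *: "length xs = n - 1" "length ys = n" "set xs \<subseteq> dual_space scale" "set ys \<subseteq> dual_space scale"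
    for xs ys
  proof -
    have "omega scale n s (id_tensor scale n \<Delta> (\<Delta> v)) (xs @ ys) =
        \<Delta> v (omit s ys @ [dual_map \<Delta> (xs @ [ys ! (s - 1)])])" if s: "s \<in> {1..n}" for s
    proof -
      obtain k where k: "s = Suc k" "k < n" using s by (cases s) auto
      have "ys ! k \<in> dual_space scale" using * k by (auto intro: subsetD)
      moreover have "set (omit s ys) \<subseteq> dual_space scale"
        by (rule order.trans[OF set_omit_subset *(4)])
      moreover have "length (omit s ys) = n - 1" using * k by (simp add: length_omit)
      moreover have "length (xs @ [ys ! k]) = n" using * n by simp
      moreover have "omega scale n s w (xs @ ys) = w (omit s ys @ xs @ [ys ! k])" for w
        using omega_pure[of xs n ys s scale w] * k by simp
      ultimately show ?thesis
        using id[of "omit s ys" "xs @ [ys ! k]"] *(3) k(1) by simp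
    qed
    then show ?thesis using id[OF *] by (simp add: sum_fun_apply tensor_scale_def)
  qed
  have outside: "?T fs = 0" if "\<not> (length fs = 2 * n - 1 \<and> set fs \<subseteq> dual_space scale)" for fs
  proof -
    have "id_tensor scale n \<Delta> (\<Delta> v) fs = 0" "\<And>s w. omega scale n s w fs = 0"
      using that unfolding id_tensor_def omega_def on_dual_def by auto
    then show ?thesis by (simp add: sum_fun_apply tensor_scale_def)
  qed
  show ?thesis
  proof
    assume z: "?T = 0"
    show ?R
    proof (intro allI impI)
      fix xs ys
      assume *: "length xs = n - 1" "length ys = n" "set xs \<subseteq> dual_space scale" "set ys \<subseteq> dual_space scale"
      have "?T (xs @ ys) = 0" unfolding z by simp
      then show "\<Delta> v (xs @ [dual_map \<Delta> ys]) =
          (\<Sum>s = 1..n. (- 1) ^ (n - s) * \<Delta> v (omit s ys @ [dual_map \<Delta> (xs @ [ys ! (s - 1)])]))"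
        unfolding T[OF *] by simp
    qed
  next
    assume R: ?R
    show "?T = 0"
    proof
      fix fs
      show "?T fs = 0 fs"
      proof (cases "length fs = 2 * n - 1 \<and> set fs \<subseteq> dual_space scale")
        case True
        let ?xs = "take (n - 1) fs" and ?ys = "drop (n - 1) fs"
        have "length ?xs = n - 1" "length ?ys = n" "set ?xs \<subseteq> dual_space scale"
            "set ?ys \<subseteq> dual_space scale"
          using True n by (auto dest: in_set_takeD in_set_dropD)
        with T[OF this] R show ?thesis by simp
      next
        case False
        then show ?thesis using outside by simp
      qed
    qed
  qed
qed

lemma alternating_multilinear_pointwise:
  fixes F :: "('v \<Rightarrow> 'a::field_char_0) list \<Rightarrow> 'w \<Rightarrow> 'a"
  assumes "\<And>v. alternating_map dual_scale (*) n (\<lambda>fs. F fs v)"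
  shows "alternating_multilinear dual_scale dual_scale n F"
proof -
  have "multilinear_map dual_scale (*) n (\<lambda>fs. F fs v)" for v
    using assms[of v] by (simp add: alternating_map_iff alternating_multilinear_def)
  then have "multilinear_map dual_scale dual_scale n F"
    unfolding multilinear_map_def Vector_Spaces.linear_iff
    by (simp add: vector_space_dual_scale fun_eq_iff) (simp add: dual_scale_def)
  moreover have "F fs = dual_scale (of_int (sign \<sigma>)) (F (permute_list \<sigma> fs))"
    if "\<sigma> permutes {..<n}" "length fs = n" for \<sigma> fs
    using alternating_map.permute[OF assms that] by (auto simp: dual_scale_def)
  ultimately show ?thesis unfolding alternating_multilinear_def by blast
qed

text \<open>
  This is \<open>x\<^sub>-\<^sub>1 \<and> \<Delta>(v)\<close> for \<open>v\<close> the \<open>L\<close>-component of \<open>w\<close>: the sum runs over the position of the factor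
  \<open>x\<^sub>-\<^sub>1\<close>, which is paired with the functional at that position.
\<close>

definition ext_cobracket ::
  "('a::field \<Rightarrow> 'v::ab_group_add \<Rightarrow> 'v) \<Rightarrow> nat \<Rightarrow> ('v \<Rightarrow> ('a, 'v) tensor)
     \<Rightarrow> 'v \<times> 'a \<times> 'a \<Rightarrow> ('a, 'v \<times> 'a \<times> 'a) tensor" where
  "ext_cobracket scale n \<Delta> w = on_dual (ext_scale scale) (n + 1)
     (\<lambda>fs. \<Sum>k\<le>n. (- 1) ^ k * (fs ! k) (0, 0, 1) * \<Delta> (fst w) (omit (Suc k) (map (\<lambda>f. f \<circ> embed) fs)))"

text \<open>
  The coordinates of a functional with respect to \<open>L\<^sup>*\<close>, \<open>x\<^sup>-\<^sup>1\<close> and \<open>x\<^sup>0\<close>. The order is chosen such that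
  \<open>x\<^sup>-\<^sup>1\<close> becomes the vector \<open>(0, 1, 0)\<close>, which is \<open>x\<^sub>0\<close> in the extension of an \<open>n\<close>-Lie algebra.
\<close>

definition split_functional ::
  "('v::ab_group_add \<times> 'a::field \<times> 'a \<Rightarrow> 'a) \<Rightarrow> ('v \<Rightarrow> 'a) \<times> 'a \<times> 'a" where
  "split_functional f = (f \<circ> embed, f (0, 0, 1), f (0, 1, 0))"

lemma linear_split_functional:
  "Vector_Spaces.linear dual_scale (ext_scale dual_scale)
    (split_functional :: ('v::ab_group_add \<times> 'a::field \<times> 'a \<Rightarrow> 'a) \<Rightarrow> _)"
  unfolding Vector_Spaces.linear_iff
  using vector_space.vector_space_ext_scale[OF vector_space_dual_scale] vector_space_dual_scale
  by (auto simp: split_functional_def dual_scale_def ext_scale_def o_def fun_eq_iff)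

locale n_lie_coalgebra_with_basis =
  n_lie_coalgebra scale n \<Delta> + finite_basis scale "{1..int m}" x
  for scale :: "'a::field_char_0 \<Rightarrow> 'v::ab_group_add \<Rightarrow> 'v"
    and n :: nat and \<Delta> :: "'v \<Rightarrow> ('a, 'v) tensor" and m :: nat and x :: "int \<Rightarrow> 'v" +
  assumes arity_pos: "n > 0"
begin

sublocale ext_basis: finite_basis "ext_scale scale" "{- 1..int m}" "ext_basis x"
  using vector_space_ext_scale basis_family_ext_basis[OF vector_space_axioms basis]
  by (simp add: finite_basis_def finite_basis_axioms_def)

text \<open>
  The bracket \<open>\<Delta>\<^sup>*\<close> of \<open>L\<^sup>*\<close>, pulled back along the retraction \<^term>\<open>linearize\<close> to the type of all
  functions. On this type it is an \<open>n\<close>-Lie algebra, so that the extension constructed above applies.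
\<close>

definition dual_bracket :: "('v \<Rightarrow> 'a) list \<Rightarrow> 'v \<Rightarrow> 'a" where
  "dual_bracket fs = dual_map \<Delta> (map linearize fs)"

lemma alternating_dual_bracket: "alternating_multilinear dual_scale dual_scale n dual_bracket"
  using alternating_linearize[OF range_Delta]
  by (intro alternating_multilinear_pointwise) (simp add: dual_bracket_def dual_map_def)

lemma co_fundamental_identity:
  assumes "length xs = n - 1" "length ys = n" "set xs \<subseteq> dual_space scale" "set ys \<subseteq> dual_space scale"
  shows "\<Delta> v (xs @ [dual_map \<Delta> ys]) =
      (\<Sum>s = 1..n. (- 1) ^ (n - s) * \<Delta> v (omit s ys @ [dual_map \<Delta> (xs @ [ys ! (s - 1)])]))"
  by (rule iffD1[OF co_identity_iff[OF linear_Delta arity_pos] co_identity, rule_format, OF assms])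

sublocale dual: n_lie_algebra dual_scale n dual_bracket
proof (intro n_lie_algebra.intro n_lie_algebra_axioms.intro vector_space_dual_scale
    alternating_dual_bracket)
  fix xs ys :: "('v \<Rightarrow> 'a) list"
  assume l: "length xs = n - 1" "length ys = n"
  have lin: "linearize (dual_map \<Delta> fs) = dual_map \<Delta> fs" for fs
    by (intro linearize_id dual_map_in_dual_space linear_Delta)
  show "dual_bracket (xs @ [dual_bracket ys]) =
      (\<Sum>s = 1..n. dual_scale ((- 1) ^ (n - s)) (dual_bracket (omit s ys @ [dual_bracket (xs @ [ys ! (s - 1)])])))"
  proof
    fix v
    have "dual_bracket (xs @ [dual_bracket ys]) v =
        \<Delta> v (map linearize xs @ [dual_map \<Delta> (map linearize ys)])"
      by (simp add: dual_bracket_def lin) (simp add: dual_map_def)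
    also have "\<dots> = (\<Sum>s = 1..n. (- 1) ^ (n - s) * \<Delta> v (omit s (map linearize ys) @
        [dual_map \<Delta> (map linearize xs @ [map linearize ys ! (s - 1)])]))"
      using l by (intro co_fundamental_identity set_linearize) simp_all
    also have "\<dots> = (\<Sum>s = 1..n. dual_scale ((- 1) ^ (n - s))
        (dual_bracket (omit s ys @ [dual_bracket (xs @ [ys ! (s - 1)])])) v)"
    proof (rule sum.cong)
      fix s assume "s \<in> {1..n}"
      then have "s - 1 < length ys" using l by auto
      then show "(- 1) ^ (n - s) * \<Delta> v (omit s (map linearize ys) @
          [dual_map \<Delta> (map linearize xs @ [map linearize ys ! (s - 1)])]) =
        dual_scale ((- 1) ^ (n - s)) (dual_bracket (omit s ys @ [dual_bracket (xs @ [ys ! (s - 1)])])) v"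
        by (simp add: dual_scale_def dual_bracket_def lin map_omit) (simp add: dual_map_def)
    qed simp
    finally show "dual_bracket (xs @ [dual_bracket ys]) v =
        (\<Sum>s = 1..n. dual_scale ((- 1) ^ (n - s)) (dual_bracket (omit s ys @ [dual_bracket (xs @ [ys ! (s - 1)])]))) v"
      unfolding sum_fun_apply .
  qed
qed

text \<open>
  With the form \<open>0\<close> the extension of \<open>L\<^sup>*\<close> has \<open>(0, 0, 1)\<close> as a central element outside the image of the
  bracket; this is \<open>x\<^sup>0\<close>.
\<close>

sublocale dual: n_lie_algebra_with_form dual_scale n dual_bracket "\<lambda>_ _. 0"
  using arity_pos
  by (intro n_lie_algebra_with_form.intro n_lie_algebra_with_form_axioms.intro dual.n_lie_algebra_axioms)
    (simp_all add: Vector_Spaces.linear_iff vector_space_dual_scale vector_space_field)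

lemma restrict_in_dual_space:
  assumes "f \<in> dual_space (ext_scale scale)"
  shows "f \<circ> embed \<in> dual_space scale"
proof -
  have "Vector_Spaces.linear scale (ext_scale scale) (embed :: 'v \<Rightarrow> 'v \<times> 'a \<times> 'a)"
    unfolding Vector_Spaces.linear_iff
    by (simp add: vector_space_axioms vector_space_ext_scale embed_def ext_scale_def)
  from Vector_Spaces.linear_compose[OF this] show ?thesis
    using assms by (simp add: dual_space_def)
qed

text \<open>
  The dual of the extended cobracket is the extended bracket of \<open>L\<^sup>*\<close>. Hence the coalgebra identity for
  the former is the fundamental identity for the latter.
\<close>

lemma ext_cobracket_eq:
  assumes "length fs = Suc n" "set fs \<subseteq> dual_space (ext_scale scale)"
  shows "ext_cobracket scale n \<Delta> w fs = fst (dual.ext_mu (map split_functional fs)) (fst w)"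
proof -
  have fst: "map fst (map split_functional fs) = map (\<lambda>f. f \<circ> embed) fs"
    by (simp add: split_functional_def)
  have "set (map (\<lambda>f. f \<circ> embed) fs) \<subseteq> dual_space scale"
    using assms(2) restrict_in_dual_space by auto
  then have "map linearize (omit (Suc k) (map (\<lambda>f. f \<circ> embed) fs)) = omit (Suc k) (map (\<lambda>f. f \<circ> embed) fs)" for k
    by (intro map_linearize_id order.trans[OF set_omit_subset])
  then show ?thesis
    using assms unfolding ext_bracket_def fst
    by (simp add: ext_cobracket_def on_dual_def sum_fun_apply dual_scale_def dual_bracket_def
        dual_map_def split_functional_def)
qed

lemma Delta_add: "\<Delta> (u + v) = \<Delta> u + \<Delta> v"
  and Delta_scale: "\<Delta> (scale c v) = tensor_scale c (\<Delta> v)"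
  and Delta_zero: "\<Delta> 0 = 0"
proof -
  interpret D: Vector_Spaces.linear scale tensor_scale \<Delta> by (rule linear_Delta)
  show "\<Delta> (u + v) = \<Delta> u + \<Delta> v" "\<Delta> (scale c v) = tensor_scale c (\<Delta> v)" "\<Delta> 0 = 0"
    by (rule D.add, rule D.scale, rule D.zero)
qed

lemma split_dual_map_ext_cobracket:
  assumes "length fs = Suc n" "set fs \<subseteq> dual_space (ext_scale scale)"
  shows "split_functional (dual_map (ext_cobracket scale n \<Delta>) fs) = dual.ext_mu (map split_functional fs)"
proof -
  have "fst (dual.ext_mu (map split_functional fs)) 0 = 0"
    by (simp add: ext_bracket_def sum_fun_apply dual_scale_def dual_bracket_def dual_map_def Delta_zero)
  then show ?thesis
    by (simp add: split_functional_def dual_map_def ext_cobracket_eq[OF assms] prod_eq_iff fun_eq_iff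
        embed_def) (simp add: ext_bracket_def)
qed

lemma linear_ext_cobracket: "Vector_Spaces.linear (ext_scale scale) tensor_scale (ext_cobracket scale n \<Delta>)"
  unfolding Vector_Spaces.linear_iff
proof (intro conjI allI vector_space_ext_scale vector_space_tensor_scale)
  fix u v :: "'v \<times> 'a \<times> 'a" and c
  show "ext_cobracket scale n \<Delta> (u + v) = ext_cobracket scale n \<Delta> u + ext_cobracket scale n \<Delta> v"
    by (simp add: fun_eq_iff ext_cobracket_def on_dual_def Delta_add distrib_left sum.distrib)
  have "(\<Sum>k\<le>n. a k * (c * b k)) = c * (\<Sum>k\<le>n. a k * b k)" for a b :: "nat \<Rightarrow> 'a"
    unfolding sum_distrib_left by (intro sum.cong refl mult.left_commute)
  then show "ext_cobracket scale n \<Delta> (ext_scale scale c v) = tensor_scale c (ext_cobracket scale n \<Delta> v)"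
    by (simp add: fun_eq_iff ext_cobracket_def on_dual_def ext_scale_def Delta_scale tensor_scale_def)
qed

lemma ext_cobracket_wedge: "ext_cobracket scale n \<Delta> w \<in> wedge_power (ext_scale scale) (n + 1)"
proof -
  let ?F = "\<lambda>fs. fst (dual.ext_mu (map split_functional fs)) (fst w)"
  have eq: "ext_cobracket scale n \<Delta> w = on_dual (ext_scale scale) (n + 1) ?F"
  proof
    fix fs
    show "ext_cobracket scale n \<Delta> w fs = on_dual (ext_scale scale) (n + 1) ?F fs"
    proof (cases "length fs = n + 1 \<and> set fs \<subseteq> dual_space (ext_scale scale)")
      case True
      then show ?thesis using ext_cobracket_eq[of fs w] unfolding on_dual_def by simp
    next
      case False
      then show ?thesis unfolding ext_cobracket_def on_dual_def by auto
    qed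
  qed
  have "multilinear_map dual_scale (*) (n + 1) ?F"
    unfolding multilinear_map_def
  proof (intro allI impI)
    fix fs :: "('v \<times> 'a \<times> 'a \<Rightarrow> 'a) list" and i
    assume "length fs = n + 1" "i < n + 1"
    then have 1: "Vector_Spaces.linear (ext_scale dual_scale) (ext_scale dual_scale)
        (\<lambda>g. dual.ext_mu ((map split_functional fs)[i := g]))"
      by (intro dual.ext_multilinear.linear_entry) simp_all
    have 2: "Vector_Spaces.linear (ext_scale dual_scale) (*) (\<lambda>g :: ('v \<Rightarrow> 'a) \<times> 'a \<times> 'a. fst g (fst w))"
      unfolding Vector_Spaces.linear_iff
      by (simp add: dual.vector_space_ext_scale vector_space_field ext_scale_def dual_scale_def)
    from Vector_Spaces.linear_compose[OF Vector_Spaces.linear_compose[OF linear_split_functional 1] 2]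
    show "Vector_Spaces.linear dual_scale (*)
        (\<lambda>g. fst (dual.ext_mu (map split_functional (fs[i := g]))) (fst w))"
      by (simp add: o_def map_update)
  qed
  then have "ext_cobracket scale n \<Delta> w \<in> tensor_power (ext_scale scale) (n + 1)"
    unfolding eq by (rule ext_basis.tensor_powerI)
  moreover have "ext_cobracket scale n \<Delta> w (permute_list \<sigma> fs) = of_int (sign \<sigma>) * ext_cobracket scale n \<Delta> w fs"
    if \<sigma>: "\<sigma> permutes {..<n + 1}" and len: "length fs = n + 1" for \<sigma> fs
  proof (cases "set fs \<subseteq> dual_space (ext_scale scale)")
    case True
    have set: "set (permute_list \<sigma> fs) = set fs" using \<sigma> len by (simp add: set_permute_list)
    have "dual.ext_mu (map split_functional fs) = ext_scale dual_scale (of_int (sign \<sigma>))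
        (dual.ext_mu (permute_list \<sigma> (map split_functional fs)))"
      using dual.ext_bracket.permute[of \<sigma> "map split_functional fs"] \<sigma> len by simp
    then have "ext_cobracket scale n \<Delta> w fs =
        of_int (sign \<sigma>) * ext_cobracket scale n \<Delta> w (permute_list \<sigma> fs)"
      using True len set \<sigma>
      by (simp add: ext_cobracket_eq ext_scale_def dual_scale_def permute_list_map)
    moreover have "(of_int (sign \<sigma>) :: 'a) * of_int (sign \<sigma>) = 1"
      by (simp flip: of_int_mult)
    ultimately show ?thesis by (simp flip: mult.assoc)
  next
    case False
    then have "\<not> set (permute_list \<sigma> fs) \<subseteq> dual_space (ext_scale scale)"
      using \<sigma> len by (simp add: set_permute_list)
    with False show ?thesis unfolding ext_cobracket_def on_dual_def by auto
  qed
  ultimately show ?thesis by (simp add: wedge_power_def)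
qed

sublocale ext_co: n_lie_coalgebra "ext_scale scale" "n + 1" "ext_cobracket scale n \<Delta>"
proof (intro n_lie_coalgebra.intro n_lie_coalgebra_axioms.intro vector_space_ext_scale
    linear_ext_cobracket ext_cobracket_wedge)
  fix w
  let ?D = "ext_cobracket scale n \<Delta>" and ?s = split_functional
  show "id_tensor (ext_scale scale) (n + 1) ?D (?D w) -
      (\<Sum>s = 1..n + 1. tensor_scale ((- 1) ^ (n + 1 - s))
        (omega (ext_scale scale) (n + 1) s (id_tensor (ext_scale scale) (n + 1) ?D (?D w)))) = 0"
    unfolding co_identity_iff[OF linear_ext_cobracket add_pos_pos[OF arity_pos zero_less_one]]
  proof (intro allI impI)
    fix xs ys
    assume l: "length xs = n + 1 - 1" "length ys = n + 1"
      and d: "set xs \<subseteq> dual_space (ext_scale scale)" "set ys \<subseteq> dual_space (ext_scale scale)"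
    note dm = dual_map_in_dual_space[OF linear_ext_cobracket]
    have "?D w (xs @ [dual_map ?D ys]) = fst (dual.ext_mu (map ?s xs @ [dual.ext_mu (map ?s ys)])) (fst w)"
      using l d dm by (subst ext_cobracket_eq) (simp_all add: split_dual_map_ext_cobracket)
    also have "\<dots> = fst (\<Sum>s = 1..n + 1. ext_scale dual_scale ((- 1) ^ (n + 1 - s))
        (dual.ext_mu (omit s (map ?s ys) @ [dual.ext_mu (map ?s xs @ [map ?s ys ! (s - 1)])]))) (fst w)"
      using l by (subst dual.ext_n_lie.fundamental_identity) simp_all
    also have "\<dots> = (\<Sum>s = 1..n + 1. (- 1) ^ (n + 1 - s) *
        fst (dual.ext_mu (omit s (map ?s ys) @ [dual.ext_mu (map ?s xs @ [map ?s ys ! (s - 1)])])) (fst w))"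
      by (simp add: fst_sum sum_fun_apply ext_scale_def dual_scale_def del: sum.cl_ivl_Suc)
    also have "\<dots> = (\<Sum>s = 1..n + 1. (- 1) ^ (n + 1 - s) * ?D w (omit s ys @ [dual_map ?D (xs @ [ys ! (s - 1)])]))"
    proof (rule sum.cong)
      fix s assume "s \<in> {1..n + 1}"
      then obtain k where k: "s = Suc k" "k < length ys" using l by (cases s) auto
      have ys: "ys ! k \<in> dual_space (ext_scale scale)" "set (omit s ys) \<subseteq> dual_space (ext_scale scale)"
        by (rule subsetD[OF d(2) nth_mem[OF k(2)]], rule order.trans[OF set_omit_subset d(2)])
      have "split_functional (dual_map ?D (xs @ [ys ! k])) = dual.ext_mu (map ?s xs @ [?s (ys ! k)])"
        using l d ys by (subst split_dual_map_ext_cobracket) simp_all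
      then have "?D w (omit s ys @ [dual_map ?D (xs @ [ys ! k])]) =
          fst (dual.ext_mu (omit s (map ?s ys) @ [dual.ext_mu (map ?s xs @ [?s (ys ! k)])])) (fst w)"
        using l d ys dm k by (subst ext_cobracket_eq) (simp_all add: length_omit map_omit)
      then show "(- 1) ^ (n + 1 - s) *
          fst (dual.ext_mu (omit s (map ?s ys) @ [dual.ext_mu (map ?s xs @ [map ?s ys ! (s - 1)])])) (fst w) =
          (- 1) ^ (n + 1 - s) * ?D w (omit s ys @ [dual_map ?D (xs @ [ys ! (s - 1)])])"
        using k by simp
    qed simp
    finally show "?D w (xs @ [dual_map ?D ys]) =
      (\<Sum>s = 1..n + 1. (- 1) ^ (n + 1 - s) * ?D w (omit s ys @ [dual_map ?D (xs @ [ys ! (s - 1)])]))" .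
  qed
qed

end

section \<open>Compatibility\<close>

locale n_lie_bialgebra_with_form_and_basis =
  n_lie_bialgebra scale n \<mu> \<Delta> + n_lie_algebra_with_form scale n \<mu> B +
  n_lie_coalgebra_with_basis scale n \<Delta> m x
  for scale :: "'a::field_char_0 \<Rightarrow> 'v::ab_group_add \<Rightarrow> 'v"
    and n :: nat and \<mu> :: "'v list \<Rightarrow> 'v" and \<Delta> :: "'v \<Rightarrow> ('a, 'v) tensor"
    and B :: "'v \<Rightarrow> 'v \<Rightarrow> 'a" and m :: nat and x :: "int \<Rightarrow> 'v"
begin

abbreviation ext_Delta :: "'v \<times> 'a \<times> 'a \<Rightarrow> ('a, 'v \<times> 'a \<times> 'a) tensor" where
  "ext_Delta \<equiv> ext_cobracket scale n \<Delta>"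

text \<open>
  On tuples of functionals this is \<open>\<Delta> v\<close>, but it is alternating on tuples of arbitrary functions, so
  that the lemmas about alternating maps apply.
\<close>

definition Delta_fun :: "'v \<Rightarrow> ('v \<Rightarrow> 'a) list \<Rightarrow> 'a" where
  "Delta_fun v gs = \<Delta> v (map linearize gs)"

lemma alternating_Delta_fun: "alternating_map dual_scale (*) n (Delta_fun v)"
  using alternating_linearize[OF range_Delta] unfolding Delta_fun_def .

lemma Delta_fun_eq: "set gs \<subseteq> dual_space scale \<Longrightarrow> \<Delta> v gs = Delta_fun v gs"
  by (simp only: Delta_fun_def map_linearize_id)

lemma compose_dual_space:
  "f \<in> dual_space s' \<Longrightarrow> Vector_Spaces.linear s s' A \<Longrightarrow> (\<lambda>y. f (A y)) \<in> dual_space s"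
  using Vector_Spaces.linear_compose[of s s' A "(*)" f] by (simp add: dual_space_def o_def)

lemma compatibility_eval:
  assumes vs: "length vs = n" and hs: "length hs = n" "set hs \<subseteq> dual_space scale"
  shows "\<Delta> (\<mu> vs) hs = (\<Sum>s<n. \<Sum>l<n. (- 1) ^ (n - Suc l) *
    Delta_fun (vs ! l) (hs[s := \<lambda>y. (hs ! s) (\<mu> (omit (Suc l) vs @ [y]))]))"
proof -
  have "rho scale n \<mu> (Suc s) (omit (Suc l) vs) (\<Delta> (vs ! l)) hs =
      Delta_fun (vs ! l) (hs[s := \<lambda>y. (hs ! s) (\<mu> (omit (Suc l) vs @ [y]))])"
    if sl: "s < n" "l < n" for s l
  proof -
    have "hs ! s \<in> dual_space scale" using hs sl by (metis nth_mem subsetD)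
    moreover have "length (omit (Suc l) vs) = n - 1" using sl vs by (simp add: length_omit)
    ultimately have "(\<lambda>y. (hs ! s) (\<mu> (omit (Suc l) vs @ [y]))) \<in> dual_space scale"
      by (rule compose_dual_space[OF _ linear_ad])
    then have "set (hs[s := \<lambda>y. (hs ! s) (\<mu> (omit (Suc l) vs @ [y]))]) \<subseteq> dual_space scale"
      by (intro order.trans[OF set_update_subset_insert]) (use hs(2) in simp)
    then show ?thesis
      using hs sl by (simp add: rho_def on_dual_def Delta_fun_eq)
  qed
  then show ?thesis
    unfolding compatibility[OF vs] sum_one_based
    by (simp add: sum_fun_apply tensor_scale_def cong: sum.cong_simp)
qed

context
  fixes ws :: "('v \<times> 'a \<times> 'a) list" and fs :: "('v \<times> 'a \<times> 'a \<Rightarrow> 'a) list"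
  assumes length_ws: "length ws = Suc n"
    and length_fs: "length fs = Suc n"
    and dual_fs: "set fs \<subseteq> dual_space (ext_scale scale)"
begin

private abbreviation "vs \<equiv> map fst ws"
private abbreviation "gs \<equiv> map (\<lambda>f. f \<circ> embed) fs"
private abbreviation "a k \<equiv> fst (snd (ws ! k))"
private abbreviation "c j \<equiv> (fs ! j) (0, 0, 1)"
private abbreviation "A l \<equiv> ad_coeff (omit (Suc l) ws)"

lemma length_omit_ws: "l \<le> n \<Longrightarrow> length (omit (Suc l) ws) = n"
  using length_ws by (simp add: length_omit)

lemma dual_gs: "set gs \<subseteq> dual_space scale"
  using dual_fs restrict_in_dual_space by auto

text \<open>
  Replacing \<open>f\<^sub>s\<close> by its composite with the adjoint map of the tuple without \<open>w\<^sub>l\<close> gives a functional that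
  vanishes on \<open>x\<^sub>-\<^sub>1\<close>, so position \<open>s\<close> does not contribute to the sum defining the cobracket. Its
  restriction to \<open>L\<close> has one part from the adjoint maps of \<open>L\<close> and one from the form \<open>B\<close>.
\<close>

lemma ext_Delta_eval:
  assumes s: "s \<le> n" and l: "l \<le> n"
  shows "ext_Delta (ws ! l) (fs[s := \<lambda>y. (fs ! s) (ext_mu (omit (Suc l) ws @ [y]))]) =
    (\<Sum>j\<in>{..n} - {s}. (- 1) ^ j * c j * Delta_fun (vs ! l) (omit (Suc j) (gs[s := \<lambda>y. (gs ! s) (A l y)]))) +
    (\<Sum>j\<in>{..n} - {s}. (- 1) ^ j * c j * c s * Delta_fun (vs ! l) (omit (Suc j) (gs[s := B (\<mu> (omit (Suc l) vs))])))"
proof -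
  interpret D: alternating_map dual_scale "(*)" n "Delta_fun (vs ! l)" by (rule alternating_Delta_fun)
  let ?f = "fs ! s" and ?u = "\<lambda>y. (gs ! s) (A l y)" and ?b = "B (\<mu> (omit (Suc l) vs))"
  let ?h = "\<lambda>y. ?f (ext_mu (omit (Suc l) ws @ [y]))"
  have f: "?f \<in> dual_space (ext_scale scale)" using dual_fs s length_fs by (auto intro: subsetD)
  have lin: "Vector_Spaces.linear (ext_scale scale) (ext_scale scale) (\<lambda>y. ext_mu (omit (Suc l) ws @ [y]))"
    using length_omit_ws[OF l] by (intro ext_multilinear.linear_snoc) simp
  have h: "?h \<in> dual_space (ext_scale scale)" by (rule compose_dual_space[OF f lin])
  have f0: "?f (v, 0, b) = (gs ! s) v + b * c s" for v b
  proof -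
    have "?f (embed v + ext_scale scale b (0, 0, 1)) = ?f (embed v) + b * c s"
      using f by (simp add: dual_space_def Vector_Spaces.linear_iff del: split_paired_All)
    then show ?thesis using s length_fs by (simp add: embed_def ext_scale_def)
  qed
  have h1: "?h (0, 0, 1) = 0"
  proof -
    have "ext_mu (omit (Suc l) ws @ [(0, 0, 1)]) = 0"
      using length_omit_ws[OF l] by (intro ext_mu_zero[of _ 1]) auto
    moreover have "?f 0 = 0"
      using f by (metis dual_space_linear module_hom.zero Vector_Spaces.linear.axioms(3))
    ultimately show ?thesis by simp
  qed
  have h2: "?h \<circ> embed = ?u + dual_scale (c s) ?b"
  proof
    fix v
    have "ext_mu (omit (Suc l) ws @ [embed v]) = (A l v, 0, ?b v)"
      using ext_mu_snoc[OF length_omit_ws[OF l], of "embed v"] by (simp add: embed_def map_omit)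
    then have "(?h \<circ> embed) v = ?f (A l v, 0, ?b v)" by (simp only: o_apply)
    also have "\<dots> = (gs ! s) (A l v) + ?b v * c s" by (rule f0)
    finally show "(?h \<circ> embed) v = (?u + dual_scale (c s) ?b) v"
      by (simp only: plus_fun_apply dual_scale_def mult.commute[of "c s"])
  qed
  have g': "map (\<lambda>f. f \<circ> embed) (fs[s := ?h]) = gs[s := ?u + dual_scale (c s) ?b]"
    unfolding map_update h2 ..
  have dual': "set (fs[s := ?h]) \<subseteq> dual_space (ext_scale scale)"
    by (rule order.trans[OF set_update_subset_insert]) (use dual_fs h in simp)
  have dual'': "set (gs[s := ?u + dual_scale (c s) ?b]) \<subseteq> dual_space scale"
    unfolding g'[symmetric] using dual' restrict_in_dual_space by auto
  have "ext_Delta (ws ! l) (fs[s := ?h]) =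
      (\<Sum>j\<le>n. (- 1) ^ j * (fs[s := ?h] ! j) (0, 0, 1) * \<Delta> (vs ! l) (omit (Suc j) (gs[s := ?u + dual_scale (c s) ?b])))"
    using dual' length_fs length_ws l unfolding ext_cobracket_def g' on_dual_def by simp
  also have "\<dots> = (\<Sum>j\<in>{..n} - {s}. (- 1) ^ j * (fs[s := ?h] ! j) (0, 0, 1) *
      \<Delta> (vs ! l) (omit (Suc j) (gs[s := ?u + dual_scale (c s) ?b])))"
    using s length_fs h1 by (intro sum.mono_neutral_right) auto
  also have "\<dots> = (\<Sum>j\<in>{..n} - {s}. (- 1) ^ j * c j * Delta_fun (vs ! l) (omit (Suc j) (gs[s := ?u])) +
      (- 1) ^ j * c j * c s * Delta_fun (vs ! l) (omit (Suc j) (gs[s := ?b])))"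
  proof (rule sum.cong)
    fix j assume "j \<in> {..n} - {s}"
    then have j: "j \<le> n" "j \<noteq> s" by auto
    have *: "omit (Suc j) (gs[s := g]) = (omit (Suc j) gs)[shift j s := g]" for g
      using j s length_fs by (intro omit_update_other) auto
    have len: "length (omit (Suc j) gs) = n" "shift j s < n"
      using j s length_fs by (simp_all add: length_omit shift_less)
    have "\<Delta> (vs ! l) (omit (Suc j) (gs[s := ?u + dual_scale (c s) ?b])) =
        Delta_fun (vs ! l) (omit (Suc j) (gs[s := ?u + dual_scale (c s) ?b]))"
      by (rule Delta_fun_eq[OF order.trans[OF set_omit_subset dual'']])
    also have "\<dots> = Delta_fun (vs ! l) (omit (Suc j) (gs[s := ?u])) +
        c s * Delta_fun (vs ! l) (omit (Suc j) (gs[s := ?b]))"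
      unfolding * by (simp only: D.add_entry[OF len] D.scale_entry[OF len])
    finally show "(- 1) ^ j * (fs[s := ?h] ! j) (0, 0, 1) * \<Delta> (vs ! l) (omit (Suc j) (gs[s := ?u + dual_scale (c s) ?b])) =
        (- 1) ^ j * c j * Delta_fun (vs ! l) (omit (Suc j) (gs[s := ?u])) +
        (- 1) ^ j * c j * c s * Delta_fun (vs ! l) (omit (Suc j) (gs[s := ?b]))"
      using j by (simp only: nth_list_update_neq[OF j(2)[symmetric]] distrib_left mult.assoc)
  qed simp
  finally show ?thesis unfolding sum.distrib .
qed

text \<open>
  In the sum over \<open>s\<close>, the terms from the form \<open>B\<close> carry two values \<open>f\<^sub>j(x\<^sub>-\<^sub>1) f\<^sub>s(x\<^sub>-\<^sub>1)\<close> and cancel in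
  pairs.
\<close>

lemma sum_ext_Delta_eval:
  assumes l: "l \<le> n"
  shows "(\<Sum>s\<le>n. ext_Delta (ws ! l) (fs[s := \<lambda>y. (fs ! s) (ext_mu (omit (Suc l) ws @ [y]))])) =
    (\<Sum>j\<le>n. (- 1) ^ j * c j * (\<Sum>s<n. Delta_fun (vs ! l)
      ((omit (Suc j) gs)[s := \<lambda>y. (omit (Suc j) gs ! s) (A l y)])))"
proof -
  interpret D: alternating_map dual_scale "(*)" n "Delta_fun (vs ! l)" by (rule alternating_Delta_fun)
  have lgs: "length gs = Suc n" using length_fs by simp
  have "(\<Sum>s\<le>n. ext_Delta (ws ! l) (fs[s := \<lambda>y. (fs ! s) (ext_mu (omit (Suc l) ws @ [y]))])) =
      (\<Sum>s\<le>n. \<Sum>j\<in>{..n} - {s}. (- 1) ^ j * c j * Delta_fun (vs ! l) (omit (Suc j) (gs[s := \<lambda>y. (gs ! s) (A l y)]))) +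
      (\<Sum>s\<le>n. \<Sum>j\<in>{..n} - {s}. (- 1) ^ j * c j * c s * Delta_fun (vs ! l) (omit (Suc j) (gs[s := B (\<mu> (omit (Suc l) vs))])))"
    unfolding sum.distrib[symmetric]
    by (intro sum.cong refl) (simp only: ext_Delta_eval[OF _ l] atMost_iff sum.distrib)
  also have "(\<Sum>s\<le>n. \<Sum>j\<in>{..n} - {s}. (- 1) ^ j * c j * c s *
      Delta_fun (vs ! l) (omit (Suc j) (gs[s := B (\<mu> (omit (Suc l) vs))]))) = 0"
    by (rule D.sum_omit_update_cancel[OF lgs])
  also have "(\<Sum>s\<le>n. \<Sum>j\<in>{..n} - {s}. (- 1) ^ j * c j * Delta_fun (vs ! l) (omit (Suc j) (gs[s := \<lambda>y. (gs ! s) (A l y)]))) =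
      (\<Sum>j\<le>n. \<Sum>s\<in>{..n} - {j}. (- 1) ^ j * c j * Delta_fun (vs ! l) (omit (Suc j) (gs[s := \<lambda>y. (gs ! s) (A l y)])))"
    by (rule sum_off_diagonal_swap)
  also have "\<dots> = (\<Sum>j\<le>n. (- 1) ^ j * c j * (\<Sum>s<n. Delta_fun (vs ! l)
      ((omit (Suc j) gs)[s := \<lambda>y. (omit (Suc j) gs ! s) (A l y)])))"
    unfolding sum_distrib_left
  proof (rule sum.cong)
    fix j assume "j \<in> {..n}"
    then have j: "j \<le> n" by simp
    show "(\<Sum>s\<in>{..n} - {j}. (- 1) ^ j * c j * Delta_fun (vs ! l) (omit (Suc j) (gs[s := \<lambda>y. (gs ! s) (A l y)]))) =
        (\<Sum>s<n. (- 1) ^ j * c j * Delta_fun (vs ! l)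
          ((omit (Suc j) gs)[s := \<lambda>y. (omit (Suc j) gs ! s) (A l y)]))"
      unfolding sum_shift[OF j]
      by (intro sum.cong refl) (use lgs j in \<open>simp only: nth_omit_shift omit_update_other
        Diff_iff atMost_iff less_Suc_eq_le insert_iff empty_iff simp_thms\<close>)
  qed simp
  finally show ?thesis by simp
qed

lemma Delta_fun_ad_coeff:
  assumes l: "l \<le> n" and hs: "length hs = n" "set hs \<subseteq> dual_space scale" and s: "s < n"
  shows "Delta_fun v (hs[s := \<lambda>y. (hs ! s) (A l y)]) =
    (\<Sum>k\<in>{..n} - {l}. (- 1) ^ shift l k * a k *
      Delta_fun v (hs[s := \<lambda>y. (hs ! s) (\<mu> (omit (Suc (shift l k)) (omit (Suc l) vs) @ [y]))]))"
proof -
  interpret D: alternating_map dual_scale "(*)" n "Delta_fun v" by (rule alternating_Delta_fun)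
  have "hs ! s \<in> dual_space scale" using hs s by (metis nth_mem subsetD)
  then interpret h: Vector_Spaces.linear scale "(*)" "hs ! s" by (simp add: dual_space_def)
  have "(\<lambda>y. (hs ! s) (A l y)) = (\<Sum>k<n. dual_scale ((- 1) ^ k * fst (snd (omit (Suc l) ws ! k)))
      (\<lambda>y. (hs ! s) (\<mu> (omit (Suc k) (omit (Suc l) vs) @ [y]))))"
    by (simp add: fun_eq_iff sum_fun_apply ad_coeff_def h.sum h.scale dual_scale_def map_omit)
  also have "\<dots> = (\<Sum>k\<in>{..n} - {l}. dual_scale ((- 1) ^ shift l k * a k)
      (\<lambda>y. (hs ! s) (\<mu> (omit (Suc (shift l k)) (omit (Suc l) vs) @ [y]))))"
    unfolding sum_shift[OF l]
    by (intro sum.cong refl) (use length_ws l in \<open>simp only: nth_omit_shift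
        Diff_iff atMost_iff less_Suc_eq_le insert_iff empty_iff simp_thms\<close>)
  finally show ?thesis
    by (simp only: D.sum_entry[OF hs(1) s] D.scale_entry[OF hs(1) s])
qed

text \<open>
  Compatibility in \<open>L\<close> for the tuple without \<open>v\<^sub>k\<close>. The double deletions are rewritten so that the
  entry \<open>v\<^sub>l\<close> to which \<open>\<Delta>\<close> is applied is deleted before \<open>v\<^sub>k\<close>, as in the extension.
\<close>

lemma Delta_mu_eval:
  assumes k: "k \<le> n" and hs: "length hs = n" "set hs \<subseteq> dual_space scale"
  shows "(- 1) ^ k * \<Delta> (\<mu> (omit (Suc k) vs)) hs =
    (\<Sum>l\<in>{..n} - {k}. (- 1) ^ (n - l) * (- 1) ^ shift l k *
      (\<Sum>s<n. Delta_fun (vs ! l) (hs[s := \<lambda>y. (hs ! s) (\<mu> (omit (Suc (shift l k)) (omit (Suc l) vs) @ [y]))])))"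
proof -
  have lvs: "length vs = Suc n" using length_ws by simp
  have sgn: "(- 1 :: 'a) ^ k * (- 1) ^ (n - Suc (shift k l)) = (- 1) ^ (n - l) * (- 1) ^ shift l k"
    if l: "l \<le> n" "l \<noteq> k" for l
  proof (cases "k < l")
    case True
    then have "n - Suc (shift k l) = n - l" "shift l k = k" using l by (auto simp: shift_def)
    then show ?thesis by (simp add: mult.commute)
  next
    case False
    with l have "l < k" by simp
    then obtain k' where k': "k = Suc k'" by (cases k) auto
    have "n - l = Suc (n - Suc l)" "shift k l = l" "shift l k = k'"
      using \<open>l < k\<close> k k' by (auto simp: shift_def)
    then show ?thesis by (simp add: k' mult.commute)
  qed
  have "length (omit (Suc k) vs) = n" using k lvs by (simp add: length_omit)
  from compatibility_eval[OF this hs]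
  have "\<Delta> (\<mu> (omit (Suc k) vs)) hs = (\<Sum>l<n. \<Sum>s<n. (- 1) ^ (n - Suc l) *
      Delta_fun (omit (Suc k) vs ! l) (hs[s := \<lambda>y. (hs ! s) (\<mu> (omit (Suc l) (omit (Suc k) vs) @ [y]))]))"
    by (subst sum.swap)
  also have "\<dots> = (\<Sum>l\<in>{..n} - {k}. \<Sum>s<n. (- 1) ^ (n - Suc (shift k l)) * Delta_fun (omit (Suc k) vs ! shift k l)
        (hs[s := \<lambda>y. (hs ! s) (\<mu> (omit (Suc (shift k l)) (omit (Suc k) vs) @ [y]))]))"
    by (rule sum_shift[OF k])
  also have "\<dots> = (\<Sum>l\<in>{..n} - {k}. \<Sum>s<n. (- 1) ^ (n - Suc (shift k l)) *
      Delta_fun (vs ! l) (hs[s := \<lambda>y. (hs ! s) (\<mu> (omit (Suc (shift l k)) (omit (Suc l) vs) @ [y]))]))"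
  proof (rule sum.cong)
    fix l assume "l \<in> {..n} - {k}"
    then have l: "k < length vs" "l < length vs" "l \<noteq> k" using k lvs by auto
    show "(\<Sum>s<n. (- 1) ^ (n - Suc (shift k l)) * Delta_fun (omit (Suc k) vs ! shift k l)
        (hs[s := \<lambda>y. (hs ! s) (\<mu> (omit (Suc (shift k l)) (omit (Suc k) vs) @ [y]))])) =
      (\<Sum>s<n. (- 1) ^ (n - Suc (shift k l)) * Delta_fun (vs ! l)
        (hs[s := \<lambda>y. (hs ! s) (\<mu> (omit (Suc (shift l k)) (omit (Suc l) vs) @ [y]))]))"
      unfolding nth_omit_shift[OF l] omit_omit[OF l] ..
  qed simp
  finally have eq: "\<Delta> (\<mu> (omit (Suc k) vs)) hs = (\<Sum>l\<in>{..n} - {k}. \<Sum>s<n. (- 1) ^ (n - Suc (shift k l)) *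
      Delta_fun (vs ! l) (hs[s := \<lambda>y. (hs ! s) (\<mu> (omit (Suc (shift l k)) (omit (Suc l) vs) @ [y]))]))" .
  show ?thesis
    unfolding eq sum_distrib_left
  proof (rule sum.cong)
    fix l assume "l \<in> {..n} - {k}"
    then have l: "l \<le> n" "l \<noteq> k" by auto
    show "(\<Sum>s<n. (- 1) ^ k * ((- 1) ^ (n - Suc (shift k l)) * Delta_fun (vs ! l)
        (hs[s := \<lambda>y. (hs ! s) (\<mu> (omit (Suc (shift l k)) (omit (Suc l) vs) @ [y]))]))) =
      (\<Sum>s<n. (- 1) ^ (n - l) * (- 1) ^ shift l k * Delta_fun (vs ! l)
        (hs[s := \<lambda>y. (hs ! s) (\<mu> (omit (Suc (shift l k)) (omit (Suc l) vs) @ [y]))]))"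
      unfolding mult.assoc[symmetric] sgn[OF l] ..
  qed simp
qed

text \<open>
  Both sides are sums over \<open>j\<close>, the position at which a functional is paired with \<open>x\<^sub>-\<^sub>1\<close>, over \<open>k\<close>, the
  entry that contributes its \<open>x\<^sub>0\<close>-coefficient, and over \<open>l\<close>, the entry to which \<open>\<Delta>\<close> is applied. They agree
  term by term after \<open>j\<close>, \<open>k\<close> and \<open>l\<close> have been put into the same order.
\<close>

lemma ext_compatibility_eval:
  "ext_Delta (ext_mu ws) fs = (\<Sum>s\<le>n. \<Sum>l\<le>n. (- 1) ^ (n - l) *
    ext_Delta (ws ! l) (fs[s := \<lambda>y. (fs ! s) (ext_mu (omit (Suc l) ws @ [y]))]))"
proof -
  define Q where "Q j l k = (\<Sum>s<n. Delta_fun (vs ! l) ((omit (Suc j) gs)[s := \<lambda>y. (omit (Suc j) gs ! s)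
      (\<mu> (omit (Suc (shift l k)) (omit (Suc l) vs) @ [y]))]))" for j l k
  have hs: "length (omit (Suc j) gs) = n" "set (omit (Suc j) gs) \<subseteq> dual_space scale" if "j \<le> n" for j
    using that length_fs order.trans[OF set_omit_subset dual_gs] by (simp_all add: length_omit)
  have "fst (ext_mu ws) = (\<Sum>k\<le>n. scale ((- 1) ^ k * a k) (\<mu> (omit (Suc k) vs)))"
    by (simp add: ext_mu_eq[OF length_ws])
  moreover have "\<Delta> (\<Sum>k\<le>n. scale ((- 1) ^ k * a k) (\<mu> (omit (Suc k) vs))) hs =
      (\<Sum>k\<le>n. (- 1) ^ k * a k * \<Delta> (\<mu> (omit (Suc k) vs)) hs)" for hs
  proof -
    interpret D: Vector_Spaces.linear scale tensor_scale \<Delta> by (rule linear_Delta)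
    show ?thesis by (simp add: D.sum D.scale sum_fun_apply tensor_scale_def)
  qed
  ultimately have "ext_Delta (ext_mu ws) fs = (\<Sum>j\<le>n. (- 1) ^ j * c j *
      (\<Sum>k\<le>n. (- 1) ^ k * a k * \<Delta> (\<mu> (omit (Suc k) vs)) (omit (Suc j) gs)))"
    using length_fs dual_fs by (simp add: ext_cobracket_def on_dual_def)
  also have "\<dots> = (\<Sum>j\<le>n. \<Sum>k\<le>n. \<Sum>l\<in>{..n} - {k}.
      (- 1) ^ (n - l) * ((- 1) ^ j * c j * ((- 1) ^ shift l k * a k * Q j l k)))"
  proof (rule sum.cong)
    fix j assume "j \<in> {..n}"
    then have j: "j \<le> n" by simp
    have "(- 1) ^ j * c j * ((- 1) ^ k * a k * \<Delta> (\<mu> (omit (Suc k) vs)) (omit (Suc j) gs)) =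
        (\<Sum>l\<in>{..n} - {k}. (- 1) ^ (n - l) * ((- 1) ^ j * c j * ((- 1) ^ shift l k * a k * Q j l k)))"
      if k: "k \<le> n" for k
    proof -
      have "(- 1) ^ j * c j * ((- 1) ^ k * a k * \<Delta> (\<mu> (omit (Suc k) vs)) (omit (Suc j) gs)) =
          (- 1) ^ j * c j * a k * ((- 1) ^ k * \<Delta> (\<mu> (omit (Suc k) vs)) (omit (Suc j) gs))"
        by (simp only: ac_simps)
      also have "\<dots> = (\<Sum>l\<in>{..n} - {k}. (- 1) ^ j * c j * a k * ((- 1) ^ (n - l) * (- 1) ^ shift l k * Q j l k))"
        unfolding Delta_mu_eval[OF k hs[OF j]] Q_def sum_distrib_left[of _ _ "{..n} - {k}"] ..
      finally show ?thesis by (simp only: ac_simps)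
    qed
    then show "(- 1) ^ j * c j * (\<Sum>k\<le>n. (- 1) ^ k * a k * \<Delta> (\<mu> (omit (Suc k) vs)) (omit (Suc j) gs)) =
        (\<Sum>k\<le>n. \<Sum>l\<in>{..n} - {k}. (- 1) ^ (n - l) * ((- 1) ^ j * c j * ((- 1) ^ shift l k * a k * Q j l k)))"
      unfolding sum_distrib_left[of _ _ "{..n}"] by (intro sum.cong) auto
  qed simp
  also have "\<dots> = (\<Sum>j\<le>n. \<Sum>l\<le>n. \<Sum>k\<in>{..n} - {l}.
      (- 1) ^ (n - l) * ((- 1) ^ j * c j * ((- 1) ^ shift l k * a k * Q j l k)))"
    by (intro sum.cong refl sum_off_diagonal_swap)
  also have "\<dots> = (\<Sum>l\<le>n. \<Sum>j\<le>n. (- 1) ^ (n - l) * ((- 1) ^ j * c j *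
      (\<Sum>k\<in>{..n} - {l}. (- 1) ^ shift l k * a k * Q j l k)))"
    unfolding sum_distrib_left by (rule sum.swap)
  also have "\<dots> = (\<Sum>l\<le>n. (- 1) ^ (n - l) *
      (\<Sum>s\<le>n. ext_Delta (ws ! l) (fs[s := \<lambda>y. (fs ! s) (ext_mu (omit (Suc l) ws @ [y]))])))"
  proof (rule sum.cong)
    fix l assume "l \<in> {..n}"
    then have l: "l \<le> n" by simp
    have "(\<Sum>k\<in>{..n} - {l}. (- 1) ^ shift l k * a k * Q j l k) =
        (\<Sum>s<n. Delta_fun (vs ! l) ((omit (Suc j) gs)[s := \<lambda>y. (omit (Suc j) gs ! s) (A l y)]))"
      if j: "j \<le> n" for j
    proof -
      have "(\<Sum>s<n. Delta_fun (vs ! l) ((omit (Suc j) gs)[s := \<lambda>y. (omit (Suc j) gs ! s) (A l y)])) =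
          (\<Sum>s<n. \<Sum>k\<in>{..n} - {l}. (- 1) ^ shift l k * a k * Delta_fun (vs ! l) ((omit (Suc j) gs)[s :=
            \<lambda>y. (omit (Suc j) gs ! s) (\<mu> (omit (Suc (shift l k)) (omit (Suc l) vs) @ [y]))]))"
        by (intro sum.cong refl Delta_fun_ad_coeff l hs j) simp
      also have "\<dots> = (\<Sum>k\<in>{..n} - {l}. (- 1) ^ shift l k * a k * Q j l k)"
        unfolding Q_def sum_distrib_left by (rule sum.swap)
      finally show ?thesis ..
    qed
    then show "(\<Sum>j\<le>n. (- 1) ^ (n - l) * ((- 1) ^ j * c j * (\<Sum>k\<in>{..n} - {l}. (- 1) ^ shift l k * a k * Q j l k))) =
        (- 1) ^ (n - l) * (\<Sum>s\<le>n. ext_Delta (ws ! l) (fs[s := \<lambda>y. (fs ! s) (ext_mu (omit (Suc l) ws @ [y]))]))"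
      unfolding sum_ext_Delta_eval[OF l] sum_distrib_left[of "(- 1) ^ (n - l)" _ "{..n}"]
      by (intro sum.cong) auto
  qed simp
  also have "\<dots> = (\<Sum>s\<le>n. \<Sum>l\<le>n. (- 1) ^ (n - l) *
      ext_Delta (ws ! l) (fs[s := \<lambda>y. (fs ! s) (ext_mu (omit (Suc l) ws @ [y]))]))"
    unfolding sum_distrib_left by (rule sum.swap)
  finally show ?thesis .
qed

end

sublocale ext_bialgebra: n_lie_bialgebra "ext_scale scale" "n + 1" ext_mu ext_Delta
proof (intro n_lie_bialgebra.intro n_lie_bialgebra_axioms.intro ext_n_lie.n_lie_algebra_axioms
    ext_co.n_lie_coalgebra_axioms)
  fix ws :: "('v \<times> 'a \<times> 'a) list"
  assume len: "length ws = n + 1"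
  show "ext_Delta (ext_mu ws) = (\<Sum>s = 1..n + 1. \<Sum>k = 1..n + 1. tensor_scale ((- 1) ^ (n + 1 - k))
      (rho (ext_scale scale) (n + 1) ext_mu s (omit k ws) (ext_Delta (ws ! (k - 1)))))"
  proof
    fix fs
    have rhs: "(\<Sum>s = 1..n + 1. \<Sum>k = 1..n + 1. tensor_scale ((- 1) ^ (n + 1 - k))
        (rho (ext_scale scale) (n + 1) ext_mu s (omit k ws) (ext_Delta (ws ! (k - 1))))) fs =
      (\<Sum>s\<le>n. \<Sum>l\<le>n. (- 1) ^ (n - l) *
        rho (ext_scale scale) (n + 1) ext_mu (Suc s) (omit (Suc l) ws) (ext_Delta (ws ! l)) fs)"
      unfolding sum_one_based by (simp add: sum_fun_apply tensor_scale_def lessThan_Suc_atMost)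
    show "ext_Delta (ext_mu ws) fs = (\<Sum>s = 1..n + 1. \<Sum>k = 1..n + 1. tensor_scale ((- 1) ^ (n + 1 - k))
      (rho (ext_scale scale) (n + 1) ext_mu s (omit k ws) (ext_Delta (ws ! (k - 1))))) fs"
    proof (cases "length fs = n + 1 \<and> set fs \<subseteq> dual_space (ext_scale scale)")
      case True
      then show ?thesis
        unfolding rhs using ext_compatibility_eval[of ws fs] len by (simp add: rho_def on_dual_def)
    next
      case False
      then have "ext_Delta (ext_mu ws) fs = 0" "\<And>s l t. rho (ext_scale scale) (n + 1) ext_mu s l t fs = 0"
        unfolding ext_cobracket_def rho_def on_dual_def by auto
      then show ?thesis unfolding rhs by simp
    qed
  qed
qed

end

section \<open>Existence and uniqueness\<close>

lemma put_at_decompose: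
  assumes "y \<in> set ys" "distinct ys"
  obtains k zs where "k < length ys" "ys = put_at (Suc k) y zs" "Suc (length zs) = length ys"
    "set zs = set ys - {y}"
proof -
  obtain us ws where ys: "ys = us @ y # ws" using assms(1) by (auto simp: in_set_conv_decomp)
  show ?thesis
    by (rule that[of "length us" "us @ ws"]) (use ys assms(2) in \<open>auto simp: put_at_def\<close>)
qed

text \<open>
  Tuples with repeated indices need no comparison, since alternating maps vanish there. This is why the
  specifications of the extended operations determine them, although they do not cover every tuple with
  repetitions.
\<close>

lemma alternating_eq_on_span:
  assumes "alternating_map scaleV scaleW n f" "alternating_map scaleV scaleW n g"
    and eq: "\<And>is. length is = n \<Longrightarrow> set is \<subseteq> I \<Longrightarrow> distinct is \<Longrightarrow> f (map e is) = g (map e is)"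
    and "length vs = n" "set vs \<subseteq> module.span scaleV (e ` I)"
  shows "f vs = g vs"
proof -
  interpret f: alternating_map scaleV scaleW n f by fact
  interpret g: alternating_map scaleV scaleW n g by fact
  show ?thesis
  proof (rule multilinear_eq_on_span[OF f.multilinear_axioms g.multilinear_axioms _ assms(4,5)])
    fix us assume len: "length us = n" and us: "set us \<subseteq> e ` I"
    have "us \<in> map e ` lists I"
      using us unfolding lists_image[symmetric] by (simp add: lists_eq_set)
    then obtain "is" where "is": "us = map e is" "set is \<subseteq> I" by auto
    show "f us = g us"
    proof (cases "distinct is")
      case True
      then show ?thesis using eq[of "is"] "is" len by simp
    next
      case False
      then have "\<not> distinct us" using "is" by (simp add: distinct_map)
      then show ?thesis using len by (simp add: f.not_distinct g.not_distinct)
    qed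
  qed
qed

lemma positive_indices:
  assumes "S \<subseteq> {- 1..int m}" "0 \<notin> S" "- 1 \<notin> S"
  shows "S \<subseteq> {1..int m}"
proof
  fix i assume "i \<in> S"
  then have "i \<noteq> 0" "i \<noteq> - 1" using assms(2,3) by metis+
  moreover have "- 1 \<le> i" "i \<le> int m" using \<open>i \<in> S\<close> assms(1) by auto
  ultimately show "i \<in> {1..int m}" by simp
qed

lemma is_ext_bracket_unique:
  fixes scale :: "'a::field_char_0 \<Rightarrow> 'v::ab_group_add \<Rightarrow> 'v"
  assumes "vector_space scale" "basis_family scale {1..int m} x"
    and f: "is_ext_bracket scale n m x \<mu> B f" and g: "is_ext_bracket scale n m x \<mu> B g"
    and len: "length ws = n + 1"
  shows "f ws = g ws"
proof (rule alternating_eq_on_span[where f = f and g = g and e = "ext_basis x" and I = "{- 1..int m}"])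
  interpret V: vector_space scale by fact
  show "alternating_map (ext_scale scale) (ext_scale scale) (n + 1) f"
    "alternating_map (ext_scale scale) (ext_scale scale) (n + 1) g"
    using f g V.vector_space_ext_scale by (simp_all add: alternating_map_iff is_ext_bracket_def)
  have "module.span (ext_scale scale) (ext_basis x ` {- 1..int m}) = UNIV"
    using basis_family_ext_basis[OF assms(1,2)] by (simp add: basis_family_def)
  then show "set ws \<subseteq> module.span (ext_scale scale) (ext_basis x ` {- 1..int m})" by simp
  fix "is" :: "int list"
  assume l: "length is = n + 1" and s: "set is \<subseteq> {- 1..int m}" and d: "distinct is"
  consider "- 1 \<in> set is" | "- 1 \<notin> set is" "0 \<in> set is" | "- 1 \<notin> set is" "0 \<notin> set is" by blast
  then show "f (map (ext_basis x) is) = g (map (ext_basis x) is)"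
  proof cases
    case 1
    obtain k js where k: "k < length is" and "is": "is = put_at (Suc k) (- 1) js"
      and js: "Suc (length js) = length is" "set js = set is - {- 1}"
      by (rule put_at_decompose[OF 1 d])
    have "set js \<subseteq> {0..int m}" using js s by force
    then show ?thesis
      using f g k js l unfolding is_ext_bracket_def "is" map_put_at by simp
  next
    case 2
    obtain k js where k: "k < length is" and "is": "is = put_at (Suc k) 0 js"
      and js: "Suc (length js) = length is" "set js = set is - {0}"
      by (rule put_at_decompose[OF 2(2) d])
    have "set js \<subseteq> {1..int m}"
    by (rule positive_indices) (use js s 2 in auto)
    then show ?thesis
      using f g k js l unfolding is_ext_bracket_def "is" map_put_at by simp
  next
    case 3
    have "set is \<subseteq> {1..int m}"
    by (rule positive_indices) (use s 3 in auto)
    then show ?thesis using f g l unfolding is_ext_bracket_def by simp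
  qed
qed (rule len)

lemma map_ext_basis: "set is \<subseteq> {1..int m} \<Longrightarrow> map (ext_basis x) is = map embed (map x is)"
  by (auto simp: ext_basis_def)

lemma (in n_lie_algebra_with_form) is_ext_bracket_ext_mu:
  "is_ext_bracket scale n m x \<mu> B ext_mu"
  unfolding is_ext_bracket_def
proof (intro conjI allI impI)
  show "alternating_multilinear (ext_scale scale) (ext_scale scale) (n + 1) ext_mu"
    by (rule ext_n_lie.alternating)
next
  fix "is" k assume l: "length is = n" "set is \<subseteq> {1..int m}" and k: "k \<in> {1..n + 1}"
  obtain k' where k': "k = Suc k'" using k by (cases k) auto
  have "(ext_basis x 0 :: 'v \<times> 'a \<times> 'a) = (0, 1, 0)" by (simp add: ext_basis_def)
  then show "ext_mu (put_at k (ext_basis x 0) (map (ext_basis x) is)) =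
      ext_scale scale ((- 1) ^ (k - 1)) (embed (\<mu> (map x is)))"
    using ext_mu_put_at[of "map x is" k'] l k k' by (simp only: map_ext_basis) simp
next
  fix "is" k assume l: "length is = n" "set is \<subseteq> {0..int m}" and k: "k \<in> {1..n + 1}"
  show "ext_mu (put_at k (ext_basis x (- 1)) (map (ext_basis x) is)) = 0"
    using l by (intro ext_mu_zero[of _ 1]) (simp_all add: length_put_at set_put_at ext_basis_def)
next
  fix "is" assume l: "length is = n + 1" "set is \<subseteq> {1..int m}"
  show "ext_mu (map (ext_basis x) is) =
      ext_scale scale (B (\<mu> (map x (take n is))) (x (is ! n))) (ext_basis x (- 1))"
    using ext_mu_embed[of "map x is"] l
    by (simp only: map_ext_basis) (simp add: take_map ext_scale_def ext_basis_def)
qed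

lemma is_ext_cobracket_unique:
  fixes scale :: "'a::field_char_0 \<Rightarrow> 'v::ab_group_add \<Rightarrow> 'v"
  assumes "vector_space scale" "basis_family scale {1..int m} x"
    and D: "is_ext_cobracket scale n m x \<Delta> D" and E: "is_ext_cobracket scale n m x \<Delta> E"
  shows "D = E"
proof
  fix w
  interpret V: vector_space scale by fact
  interpret ext_basis: finite_basis "ext_scale scale" "{- 1..int m}" "ext_basis x"
    using V.vector_space_ext_scale basis_family_ext_basis[OF assms(1,2)]
    by (simp add: finite_basis_def finite_basis_axioms_def)
  let ?d' = "ext_basis.dual"
  have wedge: "D w \<in> wedge_power (ext_scale scale) (n + 1)" "E w \<in> wedge_power (ext_scale scale) (n + 1)"
    using D E unfolding is_ext_cobracket_def Let_def by auto
  have eq: "D w (map ?d' is) = E w (map ?d' is)"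
    if l: "length is = n + 1" and s: "set is \<subseteq> {- 1..int m}" and d: "distinct is" for "is"
  proof -
    consider "0 \<in> set is \<or> set is \<subseteq> {1..int m}" | "0 \<notin> set is" "- 1 \<in> set is"
      using positive_indices[OF s] by blast
    then have "dual_map D (map ?d' is) = dual_map E (map ?d' is)"
    proof cases
      case 1
      then show ?thesis
        using D E l s unfolding is_ext_cobracket_def Let_def by auto
    next
      case 2
      obtain k js where k: "k < length is" and "is": "is = put_at (Suc k) (- 1) js"
        and js: "Suc (length js) = length is" "set js = set is - {- 1}"
        by (rule put_at_decompose[OF 2(2) d])
      have "set js \<subseteq> {1..int m}"
      by (rule positive_indices) (use js s 2 in auto)
      moreover have "length js = n" "Suc k \<in> {1..n + 1}" using js l k by auto
      ultimately show ?thesis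
        using D E unfolding is_ext_cobracket_def Let_def "is" map_put_at by auto
    qed
    from fun_cong[OF this, of w] show ?thesis by (simp add: dual_map_def)
  qed
  show "D w = E w"
  proof
    fix fs
    show "D w fs = E w fs"
    proof (cases "length fs = n + 1 \<and> set fs \<subseteq> dual_space (ext_scale scale)")
      case True
      let ?D = "\<lambda>fs. D w (map ext_basis.linearize fs)" and ?E = "\<lambda>fs. E w (map ext_basis.linearize fs)"
      have lin: "map ext_basis.linearize (map ?d' is) = map ?d' is" for "is"
        using ext_basis.dual_in_dual_space by (intro ext_basis.map_linearize_id) auto
      have "?D fs = ?E fs"
      proof (rule alternating_eq_on_span[where f = ?D and g = ?E and e = ?d' and I = "{- 1..int m}"])
        show "alternating_map dual_scale (*) (n + 1) ?D" "alternating_map dual_scale (*) (n + 1) ?E"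
          by (intro ext_basis.alternating_linearize wedge)+
        show "set fs \<subseteq> module.span dual_scale (?d' ` {- 1..int m})"
          using True ext_basis.dual_space_span by auto
      qed (use True eq in \<open>simp_all only: lin\<close>)
      then show ?thesis using True by (simp only: ext_basis.map_linearize_id)
    next
      case False
      have "D w \<in> tensor_power (ext_scale scale) (n + 1)" "E w \<in> tensor_power (ext_scale scale) (n + 1)"
        using wedge by (simp_all add: wedge_power_def)
      from this[THEN tensor_power_zero_outside, OF False] show ?thesis by simp
    qed
  qed
qed

context n_lie_coalgebra_with_basis
begin

lemma split_ext_dual:
  "split_functional (ext_basis.dual (- 1)) = (0, 1, 0)"
  "split_functional (ext_basis.dual 0) = (0, 0, 1)"
  "i \<in> {1..int m} \<Longrightarrow> split_functional (ext_basis.dual i) = embed (dual i)"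
proof -
  have lin: "Vector_Spaces.linear (ext_scale scale) (*) (\<lambda>w :: 'v \<times> 'a \<times> 'a. snd (snd w))"
    "Vector_Spaces.linear (ext_scale scale) (*) (\<lambda>w :: 'v \<times> 'a \<times> 'a. fst (snd w))"
    "Vector_Spaces.linear (ext_scale scale) scale (\<lambda>w :: 'v \<times> 'a \<times> 'a. fst w)"
    unfolding Vector_Spaces.linear_iff
    by (simp_all add: vector_space_axioms vector_space_ext_scale vector_space_field ext_scale_def)
  have "ext_basis.dual (- 1) = (\<lambda>w. snd (snd w))"
    by (rule ext_basis.dual_eqI) (use lin in \<open>auto simp: dual_space_def ext_basis_def embed_def\<close>)
  moreover have "ext_basis.dual 0 = (\<lambda>w. fst (snd w))"
    by (rule ext_basis.dual_eqI) (use lin in \<open>auto simp: dual_space_def ext_basis_def embed_def\<close>)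
  moreover have "ext_basis.dual i = (\<lambda>w. dual i (fst w))" if i: "i \<in> {1..int m}" for i
  proof (rule ext_basis.dual_eqI)
    have d: "Vector_Spaces.linear scale (*) (dual i)"
      using dual_in_dual_space by (simp add: dual_space_def)
    from Vector_Spaces.linear_compose[OF lin(3) d]
    show "(\<lambda>w. dual i (fst w)) \<in> dual_space (ext_scale scale)" by (simp add: dual_space_def o_def)
    have "dual i 0 = 0"
      using d by (metis module_hom.zero Vector_Spaces.linear.axioms(3))
    then show "dual i (fst (ext_basis x j :: 'v \<times> 'a \<times> 'a)) = (if i = j then 1 else 0)" if "j \<in> {- 1..int m}" for j
      using i that dual_apply[of i j] by (auto simp: ext_basis_def embed_def)
  qed (use i in auto)
  moreover have "dual i 0 = 0" for i
    using dual_in_dual_space[of i] by (metis dual_space_linear module_hom.zero Vector_Spaces.linear.axioms(3))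
  ultimately show "split_functional (ext_basis.dual (- 1)) = (0, 1, 0)"
    "split_functional (ext_basis.dual 0) = (0, 0, 1)"
    "i \<in> {1..int m} \<Longrightarrow> split_functional (ext_basis.dual i) = embed (dual i)"
    by (auto simp: split_functional_def embed_def fun_eq_iff)
qed

lemma map_split_ext_dual:
  "set is \<subseteq> {1..int m} \<Longrightarrow> map split_functional (map ext_basis.dual is) = map embed (map dual is)"
  by (auto simp: split_ext_dual)

lemma set_ext_dual: "set (map ext_basis.dual is) \<subseteq> dual_space (ext_scale scale)"
  using ext_basis.dual_in_dual_space by auto

lemma dual_map_ext_cobracket_zero:
  assumes "length fs = Suc n" "set fs \<subseteq> dual_space (ext_scale scale)"
    and "fst (dual.ext_mu (map split_functional fs)) = 0"
  shows "dual_map (ext_cobracket scale n \<Delta>) fs = 0"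
  using ext_cobracket_eq[OF assms(1,2)] assms(3) by (auto simp: dual_map_def)

lemma is_ext_cobracket_ext_cobracket:
  "is_ext_cobracket scale n m x \<Delta> (ext_cobracket scale n \<Delta>)"
  unfolding is_ext_cobracket_def Let_def
proof (intro conjI allI impI linear_ext_cobracket)
  show "range (ext_cobracket scale n \<Delta>) \<subseteq> wedge_power (ext_scale scale) (n + 1)"
    using ext_cobracket_wedge by auto
next
  fix "is" k assume l: "length is = n" "set is \<subseteq> {1..int m}" and k: "k \<in> {1..n + 1}"
  obtain k' where k': "k = Suc k'" using k by (cases k) auto
  let ?fs = "put_at k (ext_basis.dual (- 1)) (map ext_basis.dual is)"
  have fs: "length ?fs = Suc n" "set ?fs \<subseteq> dual_space (ext_scale scale)"
    using l set_ext_dual ext_basis.dual_in_dual_space by (auto simp: length_put_at set_put_at)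
  have "map split_functional ?fs = put_at (Suc k') (0, 1, 0) (map embed (map dual is))"
    unfolding map_put_at map_split_ext_dual[OF l(2)] split_ext_dual(1) k' ..
  then have "dual.ext_mu (map split_functional ?fs) =
      ext_scale dual_scale ((- 1) ^ k') (embed (dual_bracket (map dual is)))"
    using l k k' dual.ext_mu_put_at[of "map dual is" k'] by simp
  moreover have "dual_bracket (map dual is) = dual_map \<Delta> (map dual is)"
    unfolding dual_bracket_def using dual_in_dual_space by (subst map_linearize_id) auto
  ultimately show "dual_map (ext_cobracket scale n \<Delta>) ?fs =
      (\<lambda>w. (- 1) ^ (k - 1) * embed_dual (dual_map \<Delta> (map dual is)) w)"
    using ext_cobracket_eq[OF fs] k'
    by (auto simp: dual_map_def ext_scale_def embed_def dual_scale_def embed_dual_def)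
next
  fix "is" assume l: "length is = n + 1" "set is \<subseteq> {- 1..int m}" "0 \<in> set is"
  show "dual_map (ext_cobracket scale n \<Delta>) (map ext_basis.dual is) = 0"
  proof (rule dual_map_ext_cobracket_zero)
    have "dual.ext_mu (map split_functional (map ext_basis.dual is)) = 0"
      using l by (intro dual.ext_mu_zero[of _ 1]) (auto simp: split_ext_dual(2)[symmetric])
    then show "fst (dual.ext_mu (map split_functional (map ext_basis.dual is))) = 0" by simp
  qed (use l set_ext_dual in simp_all)
next
  fix "is" assume l: "length is = n + 1" "set is \<subseteq> {1..int m}"
  show "dual_map (ext_cobracket scale n \<Delta>) (map ext_basis.dual is) = 0"
  proof (rule dual_map_ext_cobracket_zero)
    show "fst (dual.ext_mu (map split_functional (map ext_basis.dual is))) = 0"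
      unfolding map_split_ext_dual[OF l(2)] using l by (subst dual.ext_mu_embed) simp_all
  qed (use l set_ext_dual in simp_all)
qed

end

text \<open>
  The specification determines the bracket only on tuples of the right length, and the axioms of a
  bialgebra mention no other lists.
\<close>

lemma n_lie_bialgebra_cong:
  fixes scale :: "'a::field_char_0 \<Rightarrow> 'v::ab_group_add \<Rightarrow> 'v"
  assumes "n_lie_bialgebra scale n f \<Delta>" "n > 0"
    and alt: "alternating_multilinear scale scale n g"
    and eq: "\<And>vs. length vs = n \<Longrightarrow> g vs = f vs"
  shows "n_lie_bialgebra scale n g \<Delta>"
proof -
  interpret f: n_lie_bialgebra scale n f \<Delta> by fact
  have snoc: "g (zs @ [y]) = f (zs @ [y])" if "length zs = n - 1" for zs y
    using that assms(2) by (intro eq) simp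
  have om: "length (omit s ys) = n - 1" if "s \<in> {1..n}" "length ys = n" for s and ys :: "'v list"
    using that by (cases s) (simp_all add: length_omit)
  show ?thesis
  proof (intro n_lie_bialgebra.intro n_lie_algebra.intro n_lie_algebra_axioms.intro
      n_lie_bialgebra_axioms.intro f.vector_space_axioms f.n_lie_coalgebra_axioms alt)
    fix xs ys :: "'v list" assume l: "length xs = n - 1" "length ys = n"
    show "g (xs @ [g ys]) = (\<Sum>s = 1..n. scale ((- 1) ^ (n - s)) (g (omit s ys @ [g (xs @ [ys ! (s - 1)])])))"
      unfolding eq[OF l(2)] snoc[OF l(1)] f.fundamental_identity[OF l]
      by (intro sum.cong refl) (simp add: snoc om l)
  next
    fix xs :: "'v list" assume l: "length xs = n"
    show "\<Delta> (g xs) = (\<Sum>s = 1..n. \<Sum>k = 1..n. tensor_scale ((- 1) ^ (n - k))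
        (rho scale n g s (omit k xs) (\<Delta> (xs ! (k - 1)))))"
      unfolding eq[OF l] f.compatibility[OF l] rho_def
      by (intro sum.cong refl) (simp add: snoc om l)
  qed
qed

theorem theorem4p3:
  fixes scale :: "'a::field_char_0 \<Rightarrow> 'v::ab_group_add \<Rightarrow> 'v"
    and n m :: nat
    and x :: "int \<Rightarrow> 'v"
    and \<mu> :: "'v list \<Rightarrow> 'v"
    and \<Delta> :: "'v \<Rightarrow> ('a, 'v) tensor"
    and B :: "'v \<Rightarrow> 'v \<Rightarrow> 'a"
  assumes "n \<ge> 2"
    and "n_lie_bialgebra scale n \<mu> \<Delta>"
    and "basis_family scale {1..int m} x"
    and "\<And>y. Vector_Spaces.linear scale (*) (B y)"
    and "\<And>z. Vector_Spaces.linear scale (*) (\<lambda>y. B y z)"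
    and "\<And>y z. B y z = B z y"
    and "\<And>ys y z. length ys = n - 1 \<Longrightarrow> B (\<mu> (ys @ [y])) z + B y (\<mu> (ys @ [z])) = 0"
  shows "(\<exists>\<mu>'. is_ext_bracket scale n m x \<mu> B \<mu>') \<and>
         (\<exists>\<Delta>'. is_ext_cobracket scale n m x \<Delta> \<Delta>') \<and>
         (\<forall>\<mu>' \<Delta>'. is_ext_bracket scale n m x \<mu> B \<mu>' \<and> is_ext_cobracket scale n m x \<Delta> \<Delta>' \<longrightarrow>
            n_lie_bialgebra (ext_scale scale) (n + 1) \<mu>' \<Delta>' \<and>
            vector_space.dim (ext_scale scale) UNIV = m + 2)"
proof -
  interpret L: n_lie_bialgebra scale n \<mu> \<Delta> by fact
  interpret F: finite_basis scale "{1..int m}" x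
    by unfold_locales (simp_all add: assms(3))
  interpret n_lie_algebra_with_form scale n \<mu> B
  proof (intro n_lie_algebra_with_form.intro n_lie_algebra_with_form_axioms.intro L.n_lie_algebra_axioms)
    show "n > 0" using assms(1) by simp
  qed (fact assms)+
  interpret n_lie_coalgebra_with_basis scale n \<Delta> m x
    by unfold_locales (rule arity_pos)
  interpret n_lie_bialgebra_with_form_and_basis scale n \<mu> \<Delta> B m x ..
  have dim: "vector_space.dim (ext_scale scale) UNIV = m + 2"
  proof -
    let ?b = "ext_basis x ` {- 1..int m} :: ('v \<times> 'a \<times> 'a) set"
    have b: "inj_on (ext_basis x :: int \<Rightarrow> 'v \<times> 'a \<times> 'a) {- 1..int m}" "ext.independent ?b" "ext.span ?b = UNIV"
      using ext_basis.basis by (auto simp: basis_family_def)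
    have "ext.dim UNIV = card ?b"
      using ext.dim_span_eq_card_independent[OF b(2)] b(3) by simp
    also have "\<dots> = m + 2" by (simp add: card_image[OF b(1)])
    finally show ?thesis .
  qed
  have "n_lie_bialgebra (ext_scale scale) (n + 1) \<mu>' \<Delta>'"
    if \<mu>': "is_ext_bracket scale n m x \<mu> B \<mu>'" and \<Delta>': "is_ext_cobracket scale n m x \<Delta> \<Delta>'" for \<mu>' \<Delta>'
  proof -
    have "\<Delta>' = ext_Delta"
      by (rule is_ext_cobracket_unique[OF L.vector_space_axioms assms(3) \<Delta>' is_ext_cobracket_ext_cobracket])
    moreover have "\<mu>' ws = ext_mu ws" if "length ws = n + 1" for ws
      by (rule is_ext_bracket_unique[OF L.vector_space_axioms assms(3) \<mu>' is_ext_bracket_ext_mu that])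
    moreover have "alternating_multilinear (ext_scale scale) (ext_scale scale) (n + 1) \<mu>'"
      using \<mu>' by (simp add: is_ext_bracket_def)
    ultimately show ?thesis
      using n_lie_bialgebra_cong[OF ext_bialgebra.n_lie_bialgebra_axioms] by simp
  qed
  with dim is_ext_bracket_ext_mu is_ext_cobracket_ext_cobracket show ?thesis by blast
qed

end
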